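(* Assume the standing and strengthened assumptions in the context, and let $f\in AC^1(I)$. (I) There exists a real number $a_1$ with $\lim_{x\to x_0}f_1^*(x)=a_1$ if and only if $\int_T^{x_0}\phi_2(t)W(t)^{-1}L[f(t)]\,dt$ converges; in that case $$f_1^*(x)=a_1+\int_x^{x_0}\phi_2(t)W(t)^{-1}L[f(t)]\,dt,\qquad x\in[T,x_0).$$ Moreover, the pair of conditions "$\lim_{x\to x_0}f_1^*(x)=a_1$ for some real $a_1$ and $\int_T^{x_0}(\phi_1(t)/\phi_2(t))'[f_1^*(t)-a_1]\,dt$ converges" holds if and only if the iterated improper integral $$\int_T^{x_0}\Big(\frac{\phi_1(t)}{\phi_2(t)}\Big)'dt\int_t^{x_0}\phi_2(s)W(s)^{-1}L[f(s)]\,ds$$ converges (i.e. the inner integral converges for every $t$ and the outer one converges). (II) There exists a real number $a_2$ with $\lim_{x\to x_0}f_2^*(x)=a_2$ if and only if $\int_T^{x_0}\phi_1(t)W(t)^{-1}L[f(t)]\,dt$ converges; in that case $$f_2^*(x)=a_2-\int_x^{x_0}\phi_1(t)W(t)^{-1}L[f(t)]\,dt,\qquad x\in[T,x_0).$$ There exists a real number $\gamma$ with $\lim_{x\to x_0}F^*(x)=\gamma$ if and only if $\int_T^{x_0}\Phi(t)W(t)^{-1}L[f(t)]\,dt$ converges; in that case $$F^*(x)=\gamma-\int_x^{x_0}\Phi(t)W(t)^{-1}L[f(t)]\,dt,\qquad x\in[T,x_0).$$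
   Context: Let $x_0\in\mathbb{R}\cup\{+\infty\}$, $T\in\mathbb{R}$ with $T<x_0$, and $I:=[T,x_0)$. Limits "as $x\to x_0$" are taken for $x\in I$. For differentiable $g,h$ put $W(g,h;x):=g(x)h'(x)-g'(x)h(x)$. Standing assumptions: $\phi_1,\phi_2\in C^1(I)$; $\phi_2(x)=o(\phi_1(x))$ as $x\to x_0$; $\phi_1(x)\neq0$, $\phi_2(x)\neq0$ for all $x\in I$; $W(x):=W(\phi_1,\phi_2;x)\neq0$ for all $x\in I$. Strengthened assumption: $\phi_1,\phi_2\in AC^1(I)$, where $AC^1(I)$ is the set of $C^1$ functions on $I$ whose derivative is absolutely continuous on every compact subinterval of $I$. $L$ denotes the unique operator $L[u]=u''+a_1(x)u'+a_2(x)u$ with $a_1,a_2$ locally Lebesgue-integrable on $I$ whose kernel is $\mathrm{span}(\phi_1,\phi_2)$; equivalently $L[u]=\frac{W(x)}{\phi_1(x)}\Big[\frac{\phi_1(x)^2}{W(x)}\Big(\frac{u}{\phi_1}\Big)'\Big]'$ for $u\in AC^1(I)$ (defined a.e.). For $f\in AC^1(I)$ define $f_1^*(t):=W(f,\phi_2;t)/W(t)$, $f_2^*(t):=-W(f,\phi_1;t)/W(t)$, $\Phi(x):=\phi_2(T)\phi_1(x)-\phi_1(T)\phi_2(x)$, $F^*(t):=\phi_1(T)f_1^*(t)+\phi_2(T)f_2^*(t)=W(\Phi,f;t)/W(t)$. *)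

theory Defs
  imports "HOL-Analysis.Analysis" "HOL-Library.Landau_Symbols"
begin

definition Ival :: "real \<Rightarrow> ereal \<Rightarrow> real set" where
  "Ival T x0 = {x. T \<le> x \<and> ereal x < x0}"

definition to_x0 :: "ereal \<Rightarrow> real filter" where
  "to_x0 x0 = (if x0 = \<infinity> then at_top else at_left (real_of_ereal x0))"

definition abs_cont_on :: "real \<Rightarrow> real \<Rightarrow> (real \<Rightarrow> real) \<Rightarrow> bool" where
  "abs_cont_on a b g \<longleftrightarrow>
     (\<forall>\<epsilon>>0. \<exists>\<delta>>0. \<forall>(n::nat) (u::nat \<Rightarrow> real) (v::nat \<Rightarrow> real).
        (\<forall>i<n. a \<le> u i \<and> u i \<le> v i \<and> v i \<le> b) \<and>
        (\<forall>i<n. \<forall>j<n. i \<noteq> j \<longrightarrow> v i \<le> u j \<or> v j \<le> u i) \<and>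
        (\<Sum>i<n. v i - u i) < \<delta>
        \<longrightarrow> (\<Sum>i<n. \<bar>g (v i) - g (u i)\<bar>) < \<epsilon>)"

definition AC1 :: "real \<Rightarrow> ereal \<Rightarrow> (real \<Rightarrow> real) \<Rightarrow> (real \<Rightarrow> real) \<Rightarrow> bool" where
  "AC1 T x0 g g' \<longleftrightarrow>
     (\<forall>x\<in>Ival T x0. (g has_real_derivative g' x) (at x within Ival T x0)) \<and>
     continuous_on (Ival T x0) g' \<and>
     (\<forall>a b. T \<le> a \<longrightarrow> ereal b < x0 \<longrightarrow> abs_cont_on a b g')"

definition Wr :: "(real \<Rightarrow> real) \<Rightarrow> (real \<Rightarrow> real) \<Rightarrow> (real \<Rightarrow> real) \<Rightarrow> (real \<Rightarrow> real) \<Rightarrow> real \<Rightarrow> real" where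
  "Wr g g' h h' x = g x * h' x - g' x * h x"

text \<open>L[u](x) = W(x)/phi1(x) * [ phi1^2/W * (u/phi1)' ]'(x)  (defined a.e.);
  (u/phi1)' is written out by the quotient rule.\<close>
definition Lop :: "(real \<Rightarrow> real) \<Rightarrow> (real \<Rightarrow> real) \<Rightarrow> (real \<Rightarrow> real) \<Rightarrow> (real \<Rightarrow> real)
                   \<Rightarrow> (real \<Rightarrow> real) \<Rightarrow> (real \<Rightarrow> real) \<Rightarrow> real \<Rightarrow> real" where
  "Lop p1 p1' p2 p2' u u' x =
     Wr p1 p1' p2 p2' x / p1 x *
     deriv (\<lambda>t. (p1 t)\<^sup>2 / Wr p1 p1' p2 p2' t * ((u' t * p1 t - u t * p1' t) / (p1 t)\<^sup>2)) x"

definition imp_conv :: "real \<Rightarrow> ereal \<Rightarrow> (real \<Rightarrow> real) \<Rightarrow> bool" where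
  "imp_conv a x0 g \<longleftrightarrow>
     (\<forall>y. a \<le> y \<and> ereal y < x0 \<longrightarrow> g integrable_on {a..y}) \<and>
     (\<exists>l. ((\<lambda>y. integral {a..y} g) \<longlongrightarrow> l) (to_x0 x0))"

definition tail_int :: "ereal \<Rightarrow> (real \<Rightarrow> real) \<Rightarrow> real \<Rightarrow> real" where
  "tail_int x0 g x = Lim (to_x0 x0) (\<lambda>y. integral {x..y} g)"

end

theory Submission
  imports Defs
begin

text \<open>Cramer's rule gives \<open>f = \<phi>1 f1* + \<phi>2 f2*\<close> and \<open>f' = \<phi>1' f1* + \<phi>2' f2*\<close>, and \<open>L[f]\<close> is by definition
  \<open>W/\<phi>1\<close> times the derivative of \<open>f2*\<close>; differentiating the first identity gives the derivative
  \<open>- \<phi>2/W L[f]\<close> of \<open>f1*\<close> wherever \<open>f2*\<close> is differentiable. All claims then follow from the fundamental theorem of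
  calculus for the locally absolutely continuous functions \<open>f1*\<close>, \<open>f2*\<close> and \<open>F*\<close>. That theorem rests on
  almost everywhere differentiability, which comes from Vitali's covering theorem applied directly to the difference
  quotients, without a decomposition into monotone functions.\<close>

section \<open>Families of nonoverlapping intervals\<close>

text \<open>Absolute continuity of \<open>f'\<close> yields a second derivative only almost
  everywhere, and \<open>deriv\<close> in \<open>Lop\<close> has an unspecified value at the
  remaining points. So the integrands are controlled only off a null set, and what must be excluded
  is that \<open>f1s\<close> or \<open>f2s\<close> changes across that set. The gauge integral suits
  this: one estimate on tagged divisions gives integrability and value together, with no prior
  measurability or integrability of \<open>Lf\<close>.

  The detour through \<open>f2s\<close> keeps to one exceptional set: solving
  \<open>f = \<phi>1 * f1s + \<phi>2 * f2s\<close> for \<open>f1s\<close> involves, besides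
  \<open>f2s\<close>, only continuously differentiable functions.

  Once primitives are known on every compact subinterval, an improper integral converges exactly
  when its primitive has a limit, so the equivalences and the tail formulas need no further
  estimates.\<close>

text \<open>A pair \<open>p\<close> stands for the interval from \<open>fst p\<close> to \<open>snd p\<close>, so \<open>incr (\<lambda>x. x) p\<close> is its length.\<close>

definition incr :: "(real \<Rightarrow> real) \<Rightarrow> real \<times> real \<Rightarrow> real" where
  "incr g p = g (snd p) - g (fst p)"

definition nonoverlapping :: "(real \<times> real) set \<Rightarrow> bool" where
  "nonoverlapping D \<longleftrightarrow> (\<forall>p\<in>D. fst p \<le> snd p) \<and> pairwise (\<lambda>p q. snd p \<le> fst q \<or> snd q \<le> fst p) D"

text \<open>The definition speaks of families indexed by initial segments of the naturals. A
  bijection from such a segment moves the estimate to any finite index set, here sets of pairs and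
  sets of tagged intervals.\<close>

lemma abs_cont_onE:
  assumes "abs_cont_on a b g" "\<epsilon> > 0"
  obtains \<delta> where "\<delta> > 0"
    "\<And>(J::'i set) u v. \<lbrakk>finite J; \<And>i. i \<in> J \<Longrightarrow> a \<le> u i \<and> u i \<le> v i \<and> v i \<le> b;
       pairwise (\<lambda>i j. v i \<le> u j \<or> v j \<le> u i) J; (\<Sum>i\<in>J. v i - u i) < \<delta>\<rbrakk>
       \<Longrightarrow> (\<Sum>i\<in>J. \<bar>g (v i) - g (u i)\<bar>) < \<epsilon>"
proof -
  obtain \<delta> where \<delta>: "\<delta> > 0" and D: "\<forall>(n::nat) (u::nat \<Rightarrow> real) (v::nat \<Rightarrow> real).
        (\<forall>i<n. a \<le> u i \<and> u i \<le> v i \<and> v i \<le> b) \<and>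
        (\<forall>i<n. \<forall>j<n. i \<noteq> j \<longrightarrow> v i \<le> u j \<or> v j \<le> u i) \<and>
        (\<Sum>i<n. v i - u i) < \<delta>
        \<longrightarrow> (\<Sum>i<n. \<bar>g (v i) - g (u i)\<bar>) < \<epsilon>"
    using assms(1)[unfolded abs_cont_on_def, rule_format, OF assms(2)] by (elim exE conjE)
  show thesis
  proof (rule that[OF \<delta>])
    fix J :: "'i set" and u v
    assume J: "finite J" "\<And>i. i \<in> J \<Longrightarrow> a \<le> u i \<and> u i \<le> v i \<and> v i \<le> b"
       "pairwise (\<lambda>i j. v i \<le> u j \<or> v j \<le> u i) J" "(\<Sum>i\<in>J. v i - u i) < \<delta>"
    obtain h where h: "bij_betw h {..<card J} J"
      using ex_bij_betw_nat_finite[OF J(1)] by (auto simp: atLeast0LessThan)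
    have hin: "h i \<in> J" if "i < card J" for i
      using h that by (auto simp: bij_betw_def)
    have hinj: "h i \<noteq> h j" if "i < card J" "j < card J" "i \<noteq> j" for i j
      using h that by (auto simp: bij_betw_def inj_on_def)
    have "(\<Sum>i<card J. \<bar>g (v (h i)) - g (u (h i))\<bar>) < \<epsilon>"
    proof (rule D[rule_format], intro conjI allI impI)
      show "(\<Sum>i<card J. v (h i) - u (h i)) < \<delta>"
        using sum.reindex_bij_betw[OF h, of "\<lambda>i. v i - u i"] J(4) by simp
    qed (use J(2,3) hin hinj in \<open>auto simp: pairwise_def\<close>)
    then show "(\<Sum>i\<in>J. \<bar>g (v i) - g (u i)\<bar>) < \<epsilon>"
      using sum.reindex_bij_betw[OF h, of "\<lambda>i. \<bar>g (v i) - g (u i)\<bar>"] by simp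
  qed
qed

lemma abs_cont_on_nonoverlapping:
  assumes "abs_cont_on a b g" "\<epsilon> > 0"
  shows "\<exists>\<delta>>0. \<forall>D. finite D \<longrightarrow> nonoverlapping D \<longrightarrow> (\<forall>p\<in>D. a \<le> fst p \<and> snd p \<le> b) \<longrightarrow>
       sum (incr (\<lambda>x. x)) D < \<delta> \<longrightarrow> \<bar>sum (incr g) D\<bar> < \<epsilon>"
proof (rule abs_cont_onE[OF assms, where 'i="real\<times>real"])
  fix \<delta> :: real
  assume \<delta>: "\<delta> > 0" and ac: "\<And>(J::(real\<times>real) set) u v. \<lbrakk>finite J; \<And>i. i \<in> J \<Longrightarrow> a \<le> u i \<and> u i \<le> v i \<and> v i \<le> b;
       pairwise (\<lambda>i j. v i \<le> u j \<or> v j \<le> u i) J; (\<Sum>i\<in>J. v i - u i) < \<delta>\<rbrakk>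
       \<Longrightarrow> (\<Sum>i\<in>J. \<bar>g (v i) - g (u i)\<bar>) < \<epsilon>"
  have "\<bar>sum (incr g) D\<bar> < \<epsilon>"
    if "finite D" "nonoverlapping D" "\<forall>p\<in>D. a \<le> fst p \<and> snd p \<le> b" "sum (incr (\<lambda>x. x)) D < \<delta>" for D
  proof -
    have "(\<Sum>i\<in>D. \<bar>g (snd i) - g (fst i)\<bar>) < \<epsilon>"
      using ac[of D fst snd] that by (simp add: nonoverlapping_def incr_def)
    then show ?thesis
      unfolding incr_def by (rule le_less_trans[OF sum_abs])
  qed
  then show ?thesis using \<delta> by blast
qed

text \<open>Removing one interval of \<open>B\<close> from the interval of \<open>A\<close> that
  contains it leaves a left and a right piece, and increments are additive under this cut. The same
  \<open>C\<close> serves every \<open>h\<close>, so lengths and increments of \<open>g\<close> can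
  be compared over one leftover family.\<close>

lemma nonoverlapping_complement:
  assumes "finite B" "nonoverlapping B" "finite A" "nonoverlapping A"
    "\<And>p. p \<in> B \<Longrightarrow> fst p < snd p"
    "\<And>p. p \<in> B \<Longrightarrow> \<exists>q\<in>A. fst q \<le> fst p \<and> snd p \<le> snd q"
  shows "\<exists>C. finite C \<and> nonoverlapping C \<and>
    (\<forall>p\<in>C. \<exists>q\<in>A. fst q \<le> fst p \<and> snd p \<le> snd q) \<and>
    (\<forall>h. sum (incr h) A = sum (incr h) B + sum (incr h) C)"
  using assms
proof (induction B arbitrary: A rule: finite_induct)
  case empty
  then show ?case by (intro exI[of _ A]) auto
next
  case (insert r B)
  obtain q where q: "q \<in> A" "fst q \<le> fst r" "snd r \<le> snd q"
    using insert.prems by blast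
  have rlt: "fst r < snd r" using insert.prems by auto
  define l where "l = (fst q, fst r)"
  define m where "m = (snd r, snd q)"
  define A' where "A' = insert l (insert m (A - {q}))"
  have ap: "snd p \<le> fst p' \<or> snd p' \<le> fst p" if "p \<in> A" "p' \<in> A" "p \<noteq> p'" for p p'
    using insert.prems(3) that by (auto simp: nonoverlapping_def pairwise_def)
  have al: "fst p \<le> snd p" if "p \<in> A" for p
    using insert.prems(3) that by (auto simp: nonoverlapping_def)
  have bp: "snd p \<le> fst p' \<or> snd p' \<le> fst p" if "p \<in> insert r B" "p' \<in> insert r B" "p \<noteq> p'" for p p'
    using insert.prems(1) that by (auto simp: nonoverlapping_def pairwise_def)
  have lm: "l \<noteq> m" using rlt q by (auto simp: l_def m_def)
  have nonB: "nonoverlapping B" using insert.prems(1) by (auto simp: nonoverlapping_def pairwise_def)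
  have nonA': "nonoverlapping A'"
  proof -
    define R where "R = (\<lambda>p q::real\<times>real. snd p \<le> fst q \<or> snd q \<le> fst p)"
    have "pairwise R (A - {q})"
      using ap by (auto simp: pairwise_def R_def)
    moreover have "R m p" "R p m" "R l p" "R p l" if "p \<in> A - {q}" for p
      using ap[of p q] al[of p] that q rlt unfolding l_def m_def R_def by auto
    moreover have "R l m" "R m l" using rlt by (auto simp: l_def m_def R_def)
    ultimately have "pairwise R A'"
      unfolding A'_def pairwise_insert by blast
    moreover have "fst p \<le> snd p" if "p \<in> A'" for p
      using that al q rlt unfolding A'_def l_def m_def by auto
    ultimately show ?thesis
      unfolding nonoverlapping_def R_def by blast
  qed
  have "\<exists>C. finite C \<and> nonoverlapping C \<and>
    (\<forall>p\<in>C. \<exists>q\<in>A'. fst q \<le> fst p \<and> snd p \<le> snd q) \<and>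
    (\<forall>h. sum (incr h) A' = sum (incr h) B + sum (incr h) C)"
  proof (rule insert.IH[OF nonB _ nonA'])
    show "finite A'" using insert.prems by (auto simp: A'_def)
    show "fst p < snd p" if "p \<in> B" for p using insert.prems that by auto
    fix p assume p: "p \<in> B"
    then obtain q' where q': "q' \<in> A" "fst q' \<le> fst p" "snd p \<le> snd q'"
      using insert.prems by blast
    have "snd p \<le> fst r \<or> snd r \<le> fst p" using bp[of p r] p insert.hyps by auto
    then show "\<exists>q\<in>A'. fst q \<le> fst p \<and> snd p \<le> snd q"
      using q' by (cases "q' = q") (auto simp: A'_def l_def m_def)
  qed
  then obtain C where C: "finite C" "nonoverlapping C"
    "\<forall>p\<in>C. \<exists>q\<in>A'. fst q \<le> fst p \<and> snd p \<le> snd q"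
    "\<And>h. sum (incr h) A' = sum (incr h) B + sum (incr h) C" by blast
  \<comment> \<open>As \<open>A'\<close> is a set, inserting a piece that already belongs to it adds
    nothing to the sum. Such a coincidence happens only for a degenerate piece, since a member of
    \<open>A\<close> other than \<open>q\<close> cannot overlap \<open>q\<close>; its increment is
    zero and nothing is lost.\<close>
  have l0: "incr h l = 0" if "l \<in> A - {q}" for h
  proof -
    have "fst r = fst q" using ap[of l q] al[of l] that q rlt by (auto simp: l_def)
    then show ?thesis by (simp add: incr_def l_def)
  qed
  have m0: "incr h m = 0" if "m \<in> A - {q}" for h
  proof -
    have "snd r = snd q" using ap[of m q] al[of m] that q rlt by (auto simp: m_def)
    then show ?thesis by (simp add: incr_def m_def)
  qed
  have "sum (incr h) A = sum (incr h) (insert r B) + sum (incr h) C" for h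
  proof -
    have "sum (incr h) A = incr h q + sum (incr h) (A - {q})"
      using insert.prems q by (simp add: sum.remove)
    moreover have "sum (incr h) A' = incr h l + incr h m + sum (incr h) (A - {q})"
    proof -
      have fin: "finite (A - {q})" using insert.prems by simp
      have "sum (incr h) (insert m (A - {q})) = incr h m + sum (incr h) (A - {q})"
        using m0[of h] fin by (cases "m \<in> A - {q}") (simp_all add: sum.insert_if del: Diff_iff)
      moreover have "sum (incr h) A' = incr h l + sum (incr h) (insert m (A - {q}))"
        unfolding A'_def using l0[of h] fin lm
        by (cases "l \<in> A - {q}") (simp_all add: sum.insert_if del: Diff_iff)
      ultimately show ?thesis by simp
    qed
    moreover have "incr h q = incr h l + incr h r + incr h m"
      by (simp add: incr_def l_def m_def)
    ultimately show ?thesis using insert.hyps C(4)[of h] by simp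
  qed
  moreover have "\<exists>q\<in>A. fst q \<le> fst p \<and> snd p \<le> snd q" if p: "p \<in> C" for p
  proof -
    obtain q' where q': "q'\<in>A'" "fst q' \<le> fst p" "snd p \<le> snd q'" using C(3) p by blast
    show ?thesis
      using q' q rlt unfolding A'_def l_def m_def by (auto intro: bexI[of _ q])
  qed
  ultimately show ?case using C(1,2) by blast
qed

section \<open>Finite Vitali covers and open hulls\<close>

text \<open>Vitali's theorem selects countably many disjoint intervals covering \<open>S\<close> up
  to a null set. They all lie in \<open>V\<close>, which has finite measure, so by continuity from
  above finitely many of them miss only a small part; \<open>R\<close> collects that part and the
  null set. \<open>S\<close> itself may be nonmeasurable.\<close>

lemma Vitali_intervals:
  fixes S :: "real set"
  assumes K: "\<And>p. p \<in> K \<Longrightarrow> fst p < snd p \<and> {fst p..snd p} \<subseteq> V" and V: "V \<in> lmeasurable"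
    and fine: "\<And>x d. x \<in> S \<Longrightarrow> d > 0 \<Longrightarrow> \<exists>p\<in>K. x \<in> {fst p..snd p} \<and> snd p - fst p < d"
    and "e > 0"
  obtains D R where "finite D" "D \<subseteq> K" "nonoverlapping D" "S \<subseteq> (\<Union>p\<in>D. {fst p..snd p}) \<union> R"
    "R \<in> lmeasurable" "measure lebesgue R < e"
    "measure lebesgue (\<Union>p\<in>D. {fst p..snd p}) = sum (incr (\<lambda>x. x)) D"
proof -
  let ?c = "\<lambda>p::real\<times>real. (fst p + snd p) / 2" and ?r = "\<lambda>p::real\<times>real. (snd p - fst p) / 2"
  let ?I = "\<lambda>p::real\<times>real. {fst p..snd p}"
  have cb: "cball (?c p) (?r p) = ?I p" for p
    by (auto simp: cball_eq_atLeastAtMost field_simps)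
  obtain C where C: "countable C" "C \<subseteq> K" "pairwise (\<lambda>i j. disjnt (?I i) (?I j)) C"
    "negligible (S - (\<Union>i\<in>C. ?I i))"
  proof (rule Vitali_covering_theorem_cballs[of K ?r S ?c, unfolded cb])
    show "0 < ?r i" if "i \<in> K" for i using K[OF that] by auto
    show "\<exists>i. i \<in> K \<and> x \<in> ?I i \<and> ?r i < d" if "x \<in> S" "0 < d" for x d
    proof -
      obtain p where "p \<in> K" "x \<in> ?I p" "snd p - fst p < d" using fine[OF \<open>x \<in> S\<close> \<open>0 < d\<close>] by blast
      then show ?thesis using K[of p] by (intro exI[of _ p]) auto
    qed
  qed blast
  have fin: "measure lebesgue (\<Union>p\<in>D. ?I p) = sum (incr (\<lambda>x. x)) D" "nonoverlapping D"
    if "D \<subseteq> C" "finite D" for D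
  proof -
    have "measure lebesgue (\<Union>p\<in>D. ?I p) = (\<Sum>p\<in>D. measure lebesgue (?I p))"
      by (intro measure_UNION' that pairwise_subset[OF C(3)]) auto
    also have "\<dots> = sum (incr (\<lambda>x. x)) D"
    proof (rule sum.cong[OF refl])
      fix p assume "p \<in> D"
      then have "fst p < snd p" using K[of p] that C(2) by auto
      then show "measure lebesgue (?I p) = incr (\<lambda>x. x) p" by (simp add: incr_def)
    qed
    finally show "measure lebesgue (\<Union>p\<in>D. ?I p) = sum (incr (\<lambda>x. x)) D" .
    have "snd p \<le> fst q \<or> snd q \<le> fst p" if pq: "p \<in> D" "q \<in> D" "p \<noteq> q" for p q
    proof (rule ccontr)
      assume "\<not> ?thesis"
      moreover have "disjnt (?I p) (?I q)" using C(3) pq \<open>D \<subseteq> C\<close> by (auto simp: pairwise_def)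
      moreover have "fst p < snd p" "fst q < snd q" using K pq \<open>D \<subseteq> C\<close> C(2) by blast+
      ultimately have "max (fst p) (fst q) \<in> ?I p \<inter> ?I q" by auto
      with \<open>disjnt (?I p) (?I q)\<close> show False by (auto simp: disjnt_def)
    qed
    moreover have "fst p \<le> snd p" if "p \<in> D" for p
      using K[of p] that \<open>D \<subseteq> C\<close> C(2) by auto
    ultimately show "nonoverlapping D"
      by (auto simp: nonoverlapping_def pairwise_def)
  qed
  show thesis
  proof (cases "C = {}")
    case True
    then have "negligible S" using C(4) by simp
    show ?thesis
    proof (rule that[of "{}" S])
      show "S \<in> lmeasurable" "measure lebesgue S < e"
        using \<open>negligible S\<close> \<open>e > 0\<close> by (simp_all add: negligible_iff_measure)
    qed (simp_all add: nonoverlapping_def)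
  next
    case False
    define q where "q = from_nat_into C"
    have rq: "range q = C" using False C(1) by (simp add: q_def range_from_nat_into)
    define X where "X n = (\<Union>p\<in>C. ?I p) - (\<Union>i<n. ?I (q i))" for n
    have X0: "(\<Union>p\<in>C. ?I p) \<in> lmeasurable"
    proof (rule fmeasurableI2[OF V])
      show "(\<Union>p\<in>C. ?I p) \<subseteq> V" using C(2) K by blast
      show "(\<Union>p\<in>C. ?I p) \<in> sets lebesgue" using C(1) by (intro sets.countable_UN') auto
    qed
    have Xm: "X n \<in> lmeasurable" for n
      unfolding X_def by (rule fmeasurable_Diff[OF X0]) auto
    have "(\<lambda>n. measure lebesgue (X n)) \<longlonglongrightarrow> measure lebesgue (\<Inter>n. X n)"
    proof (rule Lim_measure_decseq)
      show "range X \<subseteq> sets lebesgue" using Xm by (auto dest: fmeasurableD)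
      show "decseq X"
        unfolding decseq_def X_def by (intro allI impI Diff_mono UN_mono) auto
      show "emeasure lebesgue (X i) \<noteq> \<infinity>" for i using Xm[of i] by (auto simp: fmeasurable_def)
    qed
    moreover have "(\<Inter>n. X n) = {}"
    proof -
      have False if "\<And>n. x \<in> X n" for x
      proof -
        have "x \<in> X 0" using that by blast
        then obtain i where "x \<in> ?I (q i)" using rq by (auto simp: X_def)
        then have "x \<notin> X (Suc i)" by (auto simp: X_def)
        then show False using that by blast
      qed
      then show ?thesis by auto
    qed
    ultimately have "(\<lambda>n. measure lebesgue (X n)) \<longlonglongrightarrow> 0" by simp
    then have "eventually (\<lambda>n. measure lebesgue (X n) < e) sequentially"
      using \<open>e > 0\<close> by (rule order_tendstoD)
    then obtain n where n: "measure lebesgue (X n) < e"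
      by (auto simp: eventually_sequentially)
    let ?N = "S - (\<Union>i\<in>C. ?I i)"
    have N: "?N \<in> lmeasurable" "measure lebesgue ?N = 0"
      using C(4) by (auto simp: negligible_iff_measure)
    show ?thesis
    proof (rule that[of "q ` {..<n}" "X n \<union> ?N"])
      show "q ` {..<n} \<subseteq> K" using rq C(2) by auto
      show "S \<subseteq> (\<Union>p\<in>q ` {..<n}. ?I p) \<union> (X n \<union> ?N)" by (auto simp: X_def)
      show "measure lebesgue (X n \<union> ?N) < e"
        using measure_Un_le[of "X n" lebesgue ?N] n N Xm[of n] by (auto dest: fmeasurableD)
      show "X n \<union> ?N \<in> lmeasurable" using Xm N by auto
    qed (use fin[of "q ` {..<n}"] rq in auto)
  qed
qed

lemma lmeasurable_outer_open:
  fixes S :: "'a::euclidean_space set"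
  assumes "S \<in> lmeasurable" "e > 0"
  obtains X where "open X" "S \<subseteq> X" "X \<in> lmeasurable" "measure lebesgue X < measure lebesgue S + e"
proof -
  obtain X where X: "open X" "S \<subseteq> X" "X - S \<in> lmeasurable" "emeasure lebesgue (X - S) < ennreal e"
    using sets_lebesgue_outer_open[OF fmeasurableD[OF assms(1)] assms(2)] by blast
  have "measure lebesgue (X - S) < e"
    using X(3,4) assms(2) by (simp add: emeasure_eq_measure2 ennreal_less_iff)
  moreover have eq: "X = S \<union> (X - S)" using X(2) by blast
  moreover have "measure lebesgue (S \<union> (X - S)) \<le> measure lebesgue S + measure lebesgue (X - S)"
    using assms(1) X(3) by (intro measure_Un_le) (auto intro: fmeasurableD)
  moreover have "S \<union> (X - S) \<in> lmeasurable"
    using assms(1) X(3) by (rule fmeasurable.Un)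
  ultimately show thesis using that[OF X(1,2)] by simp
qed

section \<open>Absolutely continuous functions\<close>

text \<open>Common source of the closure properties: increments of a difference, product or
  reciprocal are bounded by those of its ingredients. Two dominating functions cover the binary
  operations; the unary ones use the same function twice.\<close>

lemma abs_cont_on_dominated:
  assumes ac: "abs_cont_on a b g1" "abs_cont_on a b g2" and "C > 0"
    and le: "\<And>u v. \<lbrakk>a \<le> u; u \<le> v; v \<le> b\<rbrakk> \<Longrightarrow> \<bar>h v - h u\<bar> \<le> C * (\<bar>g1 v - g1 u\<bar> + \<bar>g2 v - g2 u\<bar>)"
  shows "abs_cont_on a b h"
  unfolding abs_cont_on_def
proof (intro allI impI)
  fix \<epsilon> :: real assume "\<epsilon> > 0"
  then have "\<epsilon> / (2 * C) > 0" using \<open>C > 0\<close> by simp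
  let ?adm = "\<lambda>n \<delta> u v. (\<forall>i<n::nat. a \<le> u i \<and> u i \<le> v i \<and> v i \<le> b) \<and>
        (\<forall>i<n. \<forall>j<n. i \<noteq> j \<longrightarrow> v i \<le> u j \<or> v j \<le> u i) \<and> (\<Sum>i<n. v i - u i) < \<delta>"
  have "\<exists>\<delta>>0. \<forall>n u v. ?adm n \<delta> u v \<longrightarrow> (\<Sum>i<n. \<bar>g1 (v i) - g1 (u i)\<bar>) < \<epsilon> / (2 * C)"
    using ac(1)[unfolded abs_cont_on_def, rule_format, OF \<open>\<epsilon> / (2 * C) > 0\<close>] .
  moreover have "\<exists>\<delta>>0. \<forall>n u v. ?adm n \<delta> u v \<longrightarrow> (\<Sum>i<n. \<bar>g2 (v i) - g2 (u i)\<bar>) < \<epsilon> / (2 * C)"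
    using ac(2)[unfolded abs_cont_on_def, rule_format, OF \<open>\<epsilon> / (2 * C) > 0\<close>] .
  ultimately obtain \<delta>1 \<delta>2 where \<delta>1: "\<delta>1 > 0" "\<forall>n u v. ?adm n \<delta>1 u v \<longrightarrow> (\<Sum>i<n. \<bar>g1 (v i) - g1 (u i)\<bar>) < \<epsilon> / (2 * C)"
    and \<delta>2: "\<delta>2 > 0" "\<forall>n u v. ?adm n \<delta>2 u v \<longrightarrow> (\<Sum>i<n. \<bar>g2 (v i) - g2 (u i)\<bar>) < \<epsilon> / (2 * C)"
    by (elim exE conjE)
  have "(\<Sum>i<n. \<bar>h (v i) - h (u i)\<bar>) < \<epsilon>" if adm: "?adm n (min \<delta>1 \<delta>2) u v" for n u v
  proof -
    have "(\<Sum>i<n. \<bar>h (v i) - h (u i)\<bar>) \<le> (\<Sum>i<n. C * (\<bar>g1 (v i) - g1 (u i)\<bar> + \<bar>g2 (v i) - g2 (u i)\<bar>))"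
      using adm by (intro sum_mono le) auto
    also have "\<dots> = C * ((\<Sum>i<n. \<bar>g1 (v i) - g1 (u i)\<bar>) + (\<Sum>i<n. \<bar>g2 (v i) - g2 (u i)\<bar>))"
      by (simp add: sum_distrib_left sum.distrib distrib_left)
    also have "\<dots> < C * (\<epsilon> / (2 * C) + \<epsilon> / (2 * C))"
    proof (intro mult_strict_left_mono add_strict_mono \<open>C > 0\<close>)
      show "(\<Sum>i<n. \<bar>g1 (v i) - g1 (u i)\<bar>) < \<epsilon> / (2 * C)" using \<delta>1(2) adm by simp
      show "(\<Sum>i<n. \<bar>g2 (v i) - g2 (u i)\<bar>) < \<epsilon> / (2 * C)" using \<delta>2(2) adm by simp
    qed
    also have "\<dots> = \<epsilon>" using \<open>C > 0\<close> by (simp add: field_simps)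
    finally show ?thesis .
  qed
  then show "\<exists>\<delta>>0. \<forall>n u v. ?adm n \<delta> u v \<longrightarrow> (\<Sum>i<n. \<bar>h (v i) - h (u i)\<bar>) < \<epsilon>"
    using \<delta>1(1) \<delta>2(1) by (intro exI[of _ "min \<delta>1 \<delta>2"]) auto
qed

lemma abs_cont_on_id: "abs_cont_on a b (\<lambda>x. x)"
  unfolding abs_cont_on_def
proof (intro allI impI)
  fix \<epsilon> :: real assume "\<epsilon> > 0"
  moreover have "(\<Sum>i<n. \<bar>v i - u i\<bar>) = (\<Sum>i<n. v i - u i)"
    if "\<forall>i<n. a \<le> u i \<and> u i \<le> v i \<and> v i \<le> b" for n :: nat and u v
    using that by (intro sum.cong) auto
  ultimately show "\<exists>\<delta>>0. \<forall>(n::nat) u v. (\<forall>i<n. a \<le> u i \<and> u i \<le> v i \<and> v i \<le> b) \<and>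
        (\<forall>i<n. \<forall>j<n. i \<noteq> j \<longrightarrow> v i \<le> u j \<or> v j \<le> u i) \<and> (\<Sum>i<n. v i - u i) < \<delta> \<longrightarrow>
        (\<Sum>i<n. \<bar>v i - u i\<bar>) < \<epsilon>"
    by (intro exI[of _ \<epsilon>]) simp
qed

lemma continuous_on_Icc_bound:
  fixes g :: "real \<Rightarrow> real"
  assumes "continuous_on {a..b} g"
  obtains C where "C > 0" "\<And>x. x \<in> {a..b} \<Longrightarrow> \<bar>g x\<bar> \<le> C"
proof -
  have "bounded (g ` {a..b})"
    using assms by (intro compact_imp_bounded compact_continuous_image) auto
  then show thesis using that unfolding bounded_pos by auto
qed

lemma abs_cont_on_C1:
  assumes "\<And>x. x \<in> {a..b} \<Longrightarrow> (g has_real_derivative g' x) (at x within {a..b})"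
    and "continuous_on {a..b} g'"
  shows "abs_cont_on a b g"
proof -
  obtain C where C: "C > 0" "\<And>x. x \<in> {a..b} \<Longrightarrow> \<bar>g' x\<bar> \<le> C"
    using continuous_on_Icc_bound[OF assms(2)] by metis
  show ?thesis
  proof (rule abs_cont_on_dominated[OF abs_cont_on_id abs_cont_on_id C(1)])
    fix u v assume uv: "a \<le> u" "u \<le> v" "v \<le> b"
    have "norm (g v - g u) \<le> C * norm (v - u)"
      by (rule field_differentiable_bound[of "{a..b}" g g']) (use assms(1) C uv in auto)
    also have "\<dots> \<le> C * (\<bar>v - u\<bar> + \<bar>v - u\<bar>)" using C(1) by simp
    finally show "\<bar>g v - g u\<bar> \<le> C * (\<bar>v - u\<bar> + \<bar>v - u\<bar>)" by simp
  qed
qed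

lemma abs_cont_on_diff:
  assumes "abs_cont_on a b g" "abs_cont_on a b h"
  shows "abs_cont_on a b (\<lambda>x. g x - h x)"
  by (rule abs_cont_on_dominated[OF assms zero_less_one]) (unfold mult_1_left, linarith)

lemma abs_cont_on_mult:
  assumes "abs_cont_on a b g" "abs_cont_on a b h" and cont: "continuous_on {a..b} g" "continuous_on {a..b} h"
  shows "abs_cont_on a b (\<lambda>x. g x * h x)"
proof -
  obtain C where C: "C > 0" "\<And>x. x \<in> {a..b} \<Longrightarrow> \<bar>g x\<bar> \<le> C"
    using continuous_on_Icc_bound[OF cont(1)] by metis
  obtain D where D: "D > 0" "\<And>x. x \<in> {a..b} \<Longrightarrow> \<bar>h x\<bar> \<le> D"
    using continuous_on_Icc_bound[OF cont(2)] by metis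
  show ?thesis
  proof (rule abs_cont_on_dominated[OF assms(1,2), of "C + D"])
    fix u v assume uv: "a \<le> u" "u \<le> v" "v \<le> b"
    have "\<bar>g v * h v - g u * h u\<bar> = \<bar>h v * (g v - g u) + g u * (h v - h u)\<bar>"
      by (simp add: algebra_simps)
    also have "\<dots> \<le> \<bar>h v\<bar> * \<bar>g v - g u\<bar> + \<bar>g u\<bar> * \<bar>h v - h u\<bar>"
      by (metis abs_mult abs_triangle_ineq)
    also have "\<dots> \<le> (C + D) * \<bar>g v - g u\<bar> + (C + D) * \<bar>h v - h u\<bar>"
    proof (intro add_mono mult_right_mono)
      show "\<bar>h v\<bar> \<le> C + D" "\<bar>g u\<bar> \<le> C + D" using C(1) C(2)[of u] D(1) D(2)[of v] uv by auto
    qed auto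
    finally show "\<bar>g v * h v - g u * h u\<bar> \<le> (C + D) * (\<bar>g v - g u\<bar> + \<bar>h v - h u\<bar>)"
      by (simp add: distrib_left)
  qed (use C(1) D(1) in simp)
qed

lemma abs_cont_on_inverse:
  assumes "abs_cont_on a b g" and cont: "continuous_on {a..b} g" and nz: "\<And>x. x \<in> {a..b} \<Longrightarrow> g x \<noteq> 0"
  shows "abs_cont_on a b (\<lambda>x. inverse (g x))"
proof -
  obtain C where C: "C > 0" "\<And>x. x \<in> {a..b} \<Longrightarrow> \<bar>inverse (g x)\<bar> \<le> C"
    using continuous_on_Icc_bound[of a b "\<lambda>x. inverse (g x)"] continuous_on_inverse[OF cont] nz by metis
  show ?thesis
  proof (rule abs_cont_on_dominated[OF assms(1,1), of "C * C"])
    fix u v assume uv: "a \<le> u" "u \<le> v" "v \<le> b"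
    have "g u \<noteq> 0" "g v \<noteq> 0" using uv nz by auto
    then have "inverse (g v) - inverse (g u) = - (inverse (g u) * inverse (g v) * (g v - g u))"
      by (simp add: field_simps)
    then have "\<bar>inverse (g v) - inverse (g u)\<bar> = \<bar>inverse (g u)\<bar> * \<bar>inverse (g v)\<bar> * \<bar>g v - g u\<bar>"
      by (simp add: abs_mult)
    also have "\<dots> \<le> C * C * \<bar>g v - g u\<bar>"
      using C(1) C(2)[of u] C(2)[of v] uv by (intro mult_right_mono mult_mono) auto
    also have "\<dots> \<le> C * C * (\<bar>g v - g u\<bar> + \<bar>g v - g u\<bar>)"
      using C(1) by (intro mult_left_mono) auto
    finally show "\<bar>inverse (g v) - inverse (g u)\<bar> \<le> C * C * (\<bar>g v - g u\<bar> + \<bar>g v - g u\<bar>)" .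
  qed (use C(1) in simp)
qed

section \<open>Almost everywhere differentiability\<close>

lemma endpoints_in:
  fixes p :: "real \<times> real"
  assumes "fst p < snd p" "{fst p..snd p} \<subseteq> S"
  shows "fst p \<in> S" "snd p \<in> S"
  using assms by (auto simp: subset_eq)

text \<open>In terms of the upper derivate of \<open>g\<close> at \<open>x\<close>, the limsup of
  slopes over intervals shrinking to \<open>x\<close> and containing it, possibly as an endpoint:
  steepness for \<open>q\<close> forces this derivate to be at least \<open>q\<close>, and holds
  whenever it exceeds \<open>q\<close>. Hence steepness for every \<open>q\<close> means that it is
  infinite, while \<open>steep (\<lambda>x. - g x) (- p) x\<close> says that arbitrarily short
  intervals at \<open>x\<close> have slope at most \<open>p\<close>.\<close>

definition steep :: "(real \<Rightarrow> real) \<Rightarrow> real \<Rightarrow> real \<Rightarrow> bool" where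
  "steep g q x \<longleftrightarrow> (\<forall>d>0. \<exists>p. fst p < snd p \<and> x \<in> {fst p..snd p} \<and> incr (\<lambda>x. x) p < d \<and>
     q * incr (\<lambda>x. x) p \<le> incr g p)"

lemma steep_antimono:
  assumes "steep g q x" "r \<le> q"
  shows "steep g r x"
  unfolding steep_def
proof (intro allI impI)
  fix d :: real assume "d > 0"
  then obtain p where p: "fst p < snd p" "x \<in> {fst p..snd p}" "incr (\<lambda>x. x) p < d"
    "q * incr (\<lambda>x. x) p \<le> incr g p"
    using assms(1) unfolding steep_def by blast
  moreover have "r * incr (\<lambda>x. x) p \<le> q * incr (\<lambda>x. x) p"
    using p(1) assms(2) by (intro mult_right_mono) (auto simp: incr_def)
  ultimately show "\<exists>p. fst p < snd p \<and> x \<in> {fst p..snd p} \<and> incr (\<lambda>x. x) p < d \<and>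
     r * incr (\<lambda>x. x) p \<le> incr g p"
    by (intro exI[of _ p]) auto
qed

lemma not_steepE:
  assumes "\<not> steep g q x"
  obtains d where "d > 0"
    "\<And>u v. \<lbrakk>u < v; x \<in> {u..v}; v - u < d\<rbrakk> \<Longrightarrow> g v - g u < q * (v - u)"
proof -
  obtain d where d: "d > 0" and D: "\<And>p. \<lbrakk>fst p < snd p; x \<in> {fst p..snd p}; incr (\<lambda>x. x) p < d\<rbrakk>
      \<Longrightarrow> incr g p < q * incr (\<lambda>x. x) p"
    using assms unfolding steep_def not_le[symmetric] by blast
  show thesis
  proof (rule that[OF d])
    fix u v assume "u < v" "x \<in> {u..v}" "v - u < d"
    then show "g v - g u < q * (v - u)" using D[of "(u, v)"] by (simp add: incr_def)
  qed
qed

text \<open>Since the members of \<open>\<U>\<close> are open, sufficiently short steep intervals at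
  \<open>x\<close> stay inside one member and form a Vitali cover. A family of open sets is allowed,
  rather than one, so that a second cover can be placed inside the individual intervals of an
  earlier one.\<close>

lemma steep_cover:
  assumes \<U>: "\<And>U. U \<in> \<U> \<Longrightarrow> open U" "\<Union>\<U> \<in> lmeasurable"
    and S: "S \<subseteq> \<Union>\<U>" "\<And>x. x \<in> S \<Longrightarrow> steep g q x" and "e > 0"
  obtains D R where "finite D" "nonoverlapping D"
    "\<And>p. p \<in> D \<Longrightarrow> fst p < snd p" "\<And>p. p \<in> D \<Longrightarrow> \<exists>U\<in>\<U>. {fst p..snd p} \<subseteq> U"
    "S \<subseteq> (\<Union>p\<in>D. {fst p..snd p}) \<union> R" "R \<in> lmeasurable" "measure lebesgue R < e"
    "measure lebesgue (\<Union>p\<in>D. {fst p..snd p}) = sum (incr (\<lambda>x. x)) D"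
    "sum (incr (\<lambda>x. x)) D \<le> measure lebesgue (\<Union>\<U>)"
    "q * sum (incr (\<lambda>x. x)) D \<le> sum (incr g) D"
proof -
  define K where "K = {p. fst p < snd p \<and> (\<exists>U\<in>\<U>. {fst p..snd p} \<subseteq> U) \<and> q * incr (\<lambda>x. x) p \<le> incr g p}"
  have fine: "\<exists>p\<in>K. x \<in> {fst p..snd p} \<and> snd p - fst p < d" if xd: "x \<in> S" "d > 0" for x d
  proof -
    obtain U where U: "U \<in> \<U>" "x \<in> U" using S(1) xd(1) by blast
    then obtain r where r: "r > 0" "ball x r \<subseteq> U" using \<U>(1) openE by blast
    have "min d r > 0" using xd r by simp
    then obtain p where p: "fst p < snd p" "x \<in> {fst p..snd p}" "incr (\<lambda>x. x) p < min d r"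
      "q * incr (\<lambda>x. x) p \<le> incr g p"
      using S(2)[OF \<open>x \<in> S\<close>] unfolding steep_def by meson
    have "{fst p..snd p} \<subseteq> ball x r"
      using p(2,3) by (auto simp: incr_def dist_real_def)
    then have "{fst p..snd p} \<subseteq> U" using r by blast
    then show ?thesis using p U unfolding K_def
      by (intro bexI[of _ p]) (auto simp: incr_def)
  qed
  have K: "fst p < snd p \<and> {fst p..snd p} \<subseteq> \<Union>\<U>" if "p \<in> K" for p
    using that unfolding K_def by blast
  obtain D R where D: "finite D" "D \<subseteq> K" "nonoverlapping D" "S \<subseteq> (\<Union>p\<in>D. {fst p..snd p}) \<union> R"
    "R \<in> lmeasurable" "measure lebesgue R < e"
    "measure lebesgue (\<Union>p\<in>D. {fst p..snd p}) = sum (incr (\<lambda>x. x)) D"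
    using Vitali_intervals[OF K \<U>(2) fine \<open>e > 0\<close>] by blast
  show thesis
  proof (rule that[OF D(1,3) _ _ D(4-7)])
    have "(\<Union>p\<in>D. {fst p..snd p}) \<subseteq> \<Union>\<U>" using D(2) K by blast
    then show "sum (incr (\<lambda>x. x)) D \<le> measure lebesgue (\<Union>\<U>)"
      unfolding D(7)[symmetric]
      using D(1) \<U>(2) by (intro measure_mono_fmeasurable) (auto intro!: sets.finite_UN)
    show "q * sum (incr (\<lambda>x. x)) D \<le> sum (incr g) D"
      unfolding sum_distrib_left using D(2) by (intro sum_mono) (auto simp: K_def)
  qed (use D(2) in \<open>auto simp: K_def\<close>)
qed

text \<open>The number \<open>m\<close> is the Lebesgue outer measure of \<open>S\<close>, taken as
  an infimum. Sets described by slopes are not known to be measurable here, so the arguments below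
  compare outer measures only.\<close>

lemma not_negligible_outer:
  assumes "\<not> negligible S" "S \<subseteq> V" "V \<in> lmeasurable"
  shows "\<exists>m>0. (\<forall>X. X \<in> lmeasurable \<longrightarrow> S \<subseteq> X \<longrightarrow> m \<le> measure lebesgue X) \<and>
    (\<forall>e>0. \<exists>X. open X \<and> X \<in> lmeasurable \<and> S \<subseteq> X \<and> measure lebesgue X < m + e)"
proof -
  define M where "M = measure lebesgue ` {X. X \<in> lmeasurable \<and> S \<subseteq> X}"
  have M: "M \<noteq> {}" "bdd_below M"
    using assms by (auto simp: M_def intro!: bdd_belowI[of _ 0])
  have ap: "\<exists>X. X \<in> lmeasurable \<and> S \<subseteq> X \<and> measure lebesgue X < c" if "Inf M < c" for c
    using that cInf_less_iff[OF M] by (auto simp: M_def)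
  have "Inf M \<ge> 0" using M(1) by (intro cInf_greatest) (auto simp: M_def)
  moreover have "Inf M \<noteq> 0"
    using ap assms(1) unfolding negligible_outer_le by (metis less_imp_le)
  ultimately have "Inf M > 0" by simp
  moreover have "Inf M \<le> measure lebesgue X" if "X \<in> lmeasurable" "S \<subseteq> X" for X
    using that M(2) by (intro cInf_lower) (auto simp: M_def)
  moreover have "\<exists>X. open X \<and> X \<in> lmeasurable \<and> S \<subseteq> X \<and> measure lebesgue X < Inf M + e"
    if "e > 0" for e
  proof -
    obtain Y where Y: "Y \<in> lmeasurable" "S \<subseteq> Y" "measure lebesgue Y < Inf M + e / 2"
      using ap[of "Inf M + e / 2"] \<open>e > 0\<close> by auto
    obtain X where "open X" "Y \<subseteq> X" "X \<in> lmeasurable" "measure lebesgue X < measure lebesgue Y + e / 2"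
      using lmeasurable_outer_open[OF Y(1), of "e / 2"] \<open>e > 0\<close> by auto
    then show ?thesis using Y by (intro exI[of _ X]) auto
  qed
  ultimately show ?thesis by blast
qed

lemma abs_cont_on_uminus: "abs_cont_on a b g \<Longrightarrow> abs_cont_on a b (\<lambda>x. - g x)"
  by (rule abs_cont_on_dominated[OF _ _ zero_less_one]) (assumption, assumption, unfold mult_1_left, linarith)

text \<open>If a part of the set of outer measure \<open>m > 0\<close> lay in a region shorter than
  \<delta>, intervals of slope at least \<open>2 / m\<close> and total length at least
  \<open>m / 2\<close> would give \<open>g\<close> a total increment of at least 1, against absolute
  continuity with tolerance 1. The radius \<open>\<delta> / 3\<close> makes each ball shorter than
  \<delta>; local negligibility then gives the whole set.\<close>

lemma negligible_infinite_slope: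
  assumes "abs_cont_on a b g"
  shows "negligible {x\<in>{a<..<b}. \<forall>M. steep g M x}"
proof -
  obtain \<delta> where "\<delta> > 0" and ac: "\<forall>D. finite D \<longrightarrow> nonoverlapping D \<longrightarrow> (\<forall>p\<in>D. a \<le> fst p \<and> snd p \<le> b) \<longrightarrow>
       sum (incr (\<lambda>x. x)) D < \<delta> \<longrightarrow> \<bar>sum (incr g) D\<bar> < 1"
    using abs_cont_on_nonoverlapping[OF assms zero_less_one] by (elim exE conjE)
  let ?S = "{x\<in>{a<..<b}. \<forall>M. steep g M x}"
  have neg: "negligible (?S \<inter> ball c (\<delta> / 3))" for c
  proof (rule ccontr)
    let ?V = "{a<..<b} \<inter> ball c (\<delta> / 3)" and ?E = "?S \<inter> ball c (\<delta> / 3)"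
    have V: "open ?V" "?V \<in> lmeasurable" by auto
    have mV: "measure lebesgue ?V < \<delta>"
    proof -
      have "measure lebesgue ?V \<le> measure lebesgue (ball c (\<delta> / 3))"
        by (intro measure_mono_fmeasurable) auto
      also have "\<dots> < \<delta>" using \<open>\<delta> > 0\<close> by (simp add: ball_eq_greaterThanLessThan)
      finally show ?thesis .
    qed
    assume "\<not> negligible ?E"
    then have "\<exists>m>0. (\<forall>X. X \<in> lmeasurable \<longrightarrow> ?E \<subseteq> X \<longrightarrow> m \<le> measure lebesgue X) \<and>
      (\<forall>e>0. \<exists>X. open X \<and> X \<in> lmeasurable \<and> ?E \<subseteq> X \<and> measure lebesgue X < m + e)"
      by (rule not_negligible_outer[OF _ _ V(2)]) auto
    then obtain m where m: "m > 0" "\<forall>X. X \<in> lmeasurable \<longrightarrow> ?E \<subseteq> X \<longrightarrow> m \<le> measure lebesgue X"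
      by (elim exE conjE)
    obtain D R where D: "finite D" "nonoverlapping D"
      "\<And>p. p \<in> D \<Longrightarrow> fst p < snd p" "\<And>p. p \<in> D \<Longrightarrow> \<exists>U\<in>{?V}. {fst p..snd p} \<subseteq> U"
      "?E \<subseteq> (\<Union>p\<in>D. {fst p..snd p}) \<union> R" "R \<in> lmeasurable" "measure lebesgue R < m / 2"
      "measure lebesgue (\<Union>p\<in>D. {fst p..snd p}) = sum (incr (\<lambda>x. x)) D"
      "sum (incr (\<lambda>x. x)) D \<le> measure lebesgue (\<Union>{?V})"
      "2 / m * sum (incr (\<lambda>x. x)) D \<le> sum (incr g) D"
    proof (rule steep_cover[of "{?V}" ?E g "2 / m" "m / 2"])
      show "steep g (2 / m) x" if "x \<in> ?E" for x using that by blast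
    qed (use V m(1) in auto)
    have fm: "(\<Union>p\<in>D. {fst p..snd p}) \<in> lmeasurable" using D(1) by (intro fmeasurable.finite_UN) auto
    have "m \<le> measure lebesgue ((\<Union>p\<in>D. {fst p..snd p}) \<union> R)"
      using D(5,6) fm by (intro m(2)[rule_format]) auto
    also have "\<dots> \<le> sum (incr (\<lambda>x. x)) D + measure lebesgue R"
      using measure_Un_le[of "(\<Union>p\<in>D. {fst p..snd p})" lebesgue R] fm D(6,8) by (simp add: fmeasurableD)
    finally have "m / 2 \<le> sum (incr (\<lambda>x. x)) D" using D(7) by simp
    then have "1 \<le> 2 / m * sum (incr (\<lambda>x. x)) D" using m(1) by (simp add: field_simps)
    moreover have "\<bar>sum (incr g) D\<bar> < 1"
    proof (rule ac[rule_format, OF D(1,2)])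
      show "sum (incr (\<lambda>x. x)) D < \<delta>" using D(9) mV by simp
      fix p assume p: "p \<in> D"
      have "fst p \<in> ?V" "snd p \<in> ?V" using endpoints_in[OF D(3)[OF p]] D(4)[OF p] by blast+
      then show "a \<le> fst p \<and> snd p \<le> b" by auto
    qed
    ultimately show False using D(10) by linarith
  qed
  show ?thesis
    unfolding locally_negligible_alt[of ?S]
  proof
    fix x assume "x \<in> ?S"
    then show "\<exists>U. openin (top_of_set ?S) U \<and> x \<in> U \<and> negligible U"
      using \<open>\<delta> > 0\<close> by (intro exI[of _ "?S \<inter> ball x (\<delta> / 3)"] conjI openin_open_Int open_ball neg) auto
  qed
qed

text \<open>Cover the set up to small measure by disjoint intervals of slope at least \<open>q\<close>, then again,
  inside these, by disjoint intervals of slope at most \<open>p\<close>. The two families differ by intervals of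
  small total length, on which absolute continuity makes the increments of \<open>g\<close> negligible.\<close>

lemma negligible_distinct_slopes:
  assumes "abs_cont_on a b g" "p < q"
  shows "negligible {x\<in>{a<..<b}. steep g q x \<and> steep (\<lambda>x. - g x) (- p) x}"
proof (rule ccontr)
  let ?S = "{x\<in>{a<..<b}. steep g q x \<and> steep (\<lambda>x. - g x) (- p) x}"
  let ?l = "\<lambda>D. sum (incr (\<lambda>x. x)) D"
  assume "\<not> negligible ?S"
  then have "\<exists>m>0. (\<forall>X. X \<in> lmeasurable \<longrightarrow> ?S \<subseteq> X \<longrightarrow> m \<le> measure lebesgue X) \<and>
    (\<forall>e>0. \<exists>X. open X \<and> X \<in> lmeasurable \<and> ?S \<subseteq> X \<and> measure lebesgue X < m + e)"
    by (rule not_negligible_outer[of _ "{a<..<b}"]) auto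
  then obtain m where m: "m > 0" "\<forall>X. X \<in> lmeasurable \<longrightarrow> ?S \<subseteq> X \<longrightarrow> m \<le> measure lebesgue X"
    "\<forall>e>0. \<exists>X. open X \<and> X \<in> lmeasurable \<and> ?S \<subseteq> X \<and> measure lebesgue X < m + e"
    by (elim exE conjE)
  \<comment> \<open>The estimates will end in \<open>(q - p) * ?l A < 2 * \<eta>\<close>, whereas
    \<open>?l A\<close> is at least \<open>m / 2\<close>; the factor 8 turns that lower bound into
    \<open>4 * \<eta>\<close>.\<close>
  define \<eta> where "\<eta> = (q - p) * m / 8"
  have "\<eta> > 0" using assms(2) m(1) by (simp add: \<eta>_def)
  obtain \<delta> where \<delta>: "\<delta> > 0" and ac: "\<forall>D. finite D \<longrightarrow> nonoverlapping D \<longrightarrow> (\<forall>p\<in>D. a \<le> fst p \<and> snd p \<le> b) \<longrightarrow>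
       ?l D < \<delta> \<longrightarrow> \<bar>sum (incr g) D\<bar> < \<eta>"
    using abs_cont_on_nonoverlapping[OF assms(1) \<open>\<eta> > 0\<close>] by (elim exE conjE)
  \<comment> \<open>The three bounds serve, in turn, to keep \<open>?l A\<close> above
    \<open>m / 2\<close>, to bring the leftover length, below \<open>3 * e\<close>, under \<delta>,
    and to make \<open>\<bar>p\<bar>\<close> times that length at most \<eta>. Adding 1 avoids
    division by zero when \<open>p = 0\<close>.\<close>
  define e where "e = Min {m / 2, \<delta> / 3, \<eta> / (3 * (\<bar>p\<bar> + 1))}"
  have e: "e > 0" "e \<le> m / 2" "e \<le> \<delta> / 3" "e \<le> \<eta> / (3 * (\<bar>p\<bar> + 1))"
  proof -
    show "e > 0" using m(1) \<delta> \<open>\<eta> > 0\<close> by (simp add: e_def)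
    have "e \<le> r" if "r \<in> {m / 2, \<delta> / 3, \<eta> / (3 * (\<bar>p\<bar> + 1))}" for r
      unfolding e_def using that by (intro Min_le) auto
    then show "e \<le> m / 2" "e \<le> \<delta> / 3" "e \<le> \<eta> / (3 * (\<bar>p\<bar> + 1))" by blast+
  qed
  obtain X where X: "open X" "X \<in> lmeasurable" "?S \<subseteq> X" "measure lebesgue X < m + e"
    using m(3) e(1) by blast
  define V where "V = X \<inter> {a<..<b}"
  have V: "open V" "V \<in> lmeasurable" "?S \<subseteq> V" "V \<subseteq> {a<..<b}"
    using X by (auto simp: V_def)
  have mV: "measure lebesgue V < m + e"
    using measure_mono_fmeasurable[of V X lebesgue] V(2) X by (auto simp: V_def fmeasurableD)
  obtain A R where A: "finite A" "nonoverlapping A"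
      "\<And>r. r \<in> A \<Longrightarrow> fst r < snd r" "\<And>r. r \<in> A \<Longrightarrow> \<exists>U\<in>{V}. {fst r..snd r} \<subseteq> U"
      "?S \<subseteq> (\<Union>r\<in>A. {fst r..snd r}) \<union> R" "R \<in> lmeasurable" "measure lebesgue R < e"
      "measure lebesgue (\<Union>r\<in>A. {fst r..snd r}) = ?l A"
      "?l A \<le> measure lebesgue (\<Union>{V})"
      "q * ?l A \<le> sum (incr g) A"
  proof (rule steep_cover[of "{V}" ?S g q e])
    show "steep g q x" if "x \<in> ?S" for x using that by blast
  qed (use V e(1) in auto)
  have fmA: "(\<Union>r\<in>A. {fst r..snd r}) \<in> lmeasurable"
    using A(1) by (intro fmeasurable.finite_UN) auto
  \<comment> \<open>Passing to open intervals, as \<open>steep_cover\<close> demands, loses only the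
    finitely many endpoints \<open>?F\<close>, which have measure zero.\<close>
  let ?\<U> = "(\<lambda>r. {fst r<..<snd r}) ` A" and ?E = "?S \<inter> (\<Union>r\<in>A. {fst r<..<snd r})"
  obtain B R' where B: "finite B" "nonoverlapping B"
      "\<And>r. r \<in> B \<Longrightarrow> fst r < snd r" "\<And>r. r \<in> B \<Longrightarrow> \<exists>U\<in>?\<U>. {fst r..snd r} \<subseteq> U"
      "?E \<subseteq> (\<Union>r\<in>B. {fst r..snd r}) \<union> R'" "R' \<in> lmeasurable" "measure lebesgue R' < e"
      "measure lebesgue (\<Union>r\<in>B. {fst r..snd r}) = ?l B"
      "?l B \<le> measure lebesgue (\<Union>?\<U>)"
      "- p * ?l B \<le> sum (incr (\<lambda>x. - g x)) B"
  proof (rule steep_cover[of ?\<U> ?E "\<lambda>x. - g x" "- p" e])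
    show "\<Union>?\<U> \<in> lmeasurable" using A(1) by (intro fmeasurable.finite_Union) auto
    show "steep (\<lambda>x. - g x) (- p) x" if "x \<in> ?E" for x using that by blast
  qed (use e(1) in auto)
  have Bsub: "\<exists>s\<in>A. fst s \<le> fst r \<and> snd r \<le> snd s" if rB: "r \<in> B" for r
  proof -
    obtain s where "s \<in> A" "{fst r..snd r} \<subseteq> {fst s<..<snd s}" using B(4)[OF rB] by blast
    then show ?thesis using endpoints_in[OF B(3)[OF rB]] by (intro bexI[of _ s]) force+
  qed
  obtain C where C: "finite C" "nonoverlapping C" "\<forall>r\<in>C. \<exists>s\<in>A. fst s \<le> fst r \<and> snd r \<le> snd s"
    "\<And>h. sum (incr h) A = sum (incr h) B + sum (incr h) C"
    using nonoverlapping_complement[OF B(1,2) A(1,2) B(3) Bsub] by blast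
  have fmB: "(\<Union>r\<in>B. {fst r..snd r}) \<in> lmeasurable"
    using B(1) by (intro fmeasurable.finite_UN) auto
  have A_lower: "m - e \<le> ?l A"
  proof -
    have "m \<le> measure lebesgue ((\<Union>r\<in>A. {fst r..snd r}) \<union> R)"
      using A(5,6) fmA by (intro m(2)[rule_format]) auto
    also have "\<dots> \<le> ?l A + measure lebesgue R"
      using measure_Un_le[of "(\<Union>r\<in>A. {fst r..snd r})" lebesgue R] fmA A(6,8) by (simp add: fmeasurableD)
    finally show ?thesis using A(7) by simp
  qed
  have B_lower: "m - 2 * e \<le> ?l B"
  proof -
    let ?F = "fst ` A \<union> snd ` A"
    have F: "?F \<in> lmeasurable" "measure lebesgue ?F = 0"
      using A(1) negligible_finite[of ?F] by (auto simp: negligible_iff_measure)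
    have bd: "(\<Union>r\<in>A. {fst r..snd r}) \<subseteq> (\<Union>r\<in>A. {fst r<..<snd r}) \<union> ?F"
      by force
    have cover: "S' \<subseteq> Y \<union> (R \<union> (R' \<union> F'))" if "X \<subseteq> X' \<union> F'" "S' \<subseteq> X \<union> R" "S' \<inter> X' \<subseteq> Y \<union> R'"
      for S' X X' Y F' :: "real set"
      using that by blast
    have "?S \<subseteq> (\<Union>r\<in>B. {fst r..snd r}) \<union> (R \<union> (R' \<union> ?F))"
      by (rule cover[OF bd A(5) B(5)])
    then have "m \<le> measure lebesgue ((\<Union>r\<in>B. {fst r..snd r}) \<union> (R \<union> (R' \<union> ?F)))"
      using A(6) B(6) F fmB by (intro m(2)[rule_format]) auto
    also have "\<dots> \<le> ?l B + measure lebesgue (R \<union> (R' \<union> ?F))"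
      using measure_Un_le[of "(\<Union>r\<in>B. {fst r..snd r})" lebesgue "R \<union> (R' \<union> ?F)"] fmB A(6) B(6,8) F
      by (simp add: fmeasurableD)
    also have "measure lebesgue (R \<union> (R' \<union> ?F)) \<le> measure lebesgue R + measure lebesgue (R' \<union> ?F)"
      using A(6) B(6) F by (intro measure_Un_le) (auto intro: fmeasurableD)
    also have "measure lebesgue (R' \<union> ?F) \<le> measure lebesgue R' + measure lebesgue ?F"
      using B(6) F by (intro measure_Un_le) (auto intro: fmeasurableD)
    finally show ?thesis using A(7) B(7) F(2) by simp
  qed
  have lC: "?l A = ?l B + ?l C" by (rule C(4))
  have "?l A < m + e" using A(9) mV by simp
  \<comment> \<open>\<open>3 * e\<close> is the gap between the upper bound \<open>m + e\<close> for
    \<open>?l A\<close> and the lower bound \<open>m - 2 * e\<close> for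
    \<open>?l B\<close>.\<close>
  then have C_upper: "?l C < 3 * e" using lC B_lower by linarith
  have "?l C \<ge> 0" using C(2) by (intro sum_nonneg) (auto simp: nonoverlapping_def incr_def)
  have "\<bar>sum (incr g) C\<bar> < \<eta>"
  proof (rule ac[rule_format, OF C(1,2)])
    show "?l C < \<delta>" using C_upper e(3) by simp
    fix r assume "r \<in> C"
    then obtain s where s: "s \<in> A" "fst s \<le> fst r" "snd r \<le> snd s" using C(3) by blast
    have "fst s \<in> V" "snd s \<in> V" using endpoints_in[OF A(3)] A(4) s(1) by blast+
    then have "a \<le> fst s" "snd s \<le> b" using V(4) by auto
    then show "a \<le> fst r \<and> snd r \<le> b" using s by simp
  qed
  moreover have "sum (incr g) B \<le> p * ?l B"
  proof -
    have "sum (incr (\<lambda>x. - g x)) B = - sum (incr g) B"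
      by (simp add: incr_def sum_negf[symmetric])
    then show ?thesis using B(10) by simp
  qed
  \<comment> \<open>The increment of \<open>g\<close> over \<open>A\<close> is at least
    \<open>q * ?l A\<close>; it is also the sum of the increment over \<open>B\<close>, at most
    \<open>p * ?l B\<close>, and the one over \<open>C\<close>, below \<eta>.\<close>
  ultimately have lt: "q * ?l A < p * ?l B + \<eta>" using A(10) C(4)[of g] by linarith
  have pB: "p * ?l B = p * ?l A - p * ?l C" using lC by (simp add: algebra_simps)
  have pC: "- (p * ?l C) \<le> \<eta>"
  proof -
    have "- (p * ?l C) \<le> \<bar>p\<bar> * ?l C"
      using \<open>?l C \<ge> 0\<close> by (metis abs_ge_minus_self abs_mult abs_of_nonneg)
    also have "\<dots> \<le> (\<bar>p\<bar> + 1) * (3 * e)"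
      using C_upper \<open>?l C \<ge> 0\<close> by (intro mult_mono) auto
    also have "\<dots> \<le> \<eta>" using e(4) by (simp add: field_simps)
    finally show ?thesis .
  qed
  have "(q - p) * ?l A < 2 * \<eta>" using lt pB pC by (simp add: algebra_simps)
  moreover have "(q - p) * (m / 2) \<le> (q - p) * ?l A"
    using A_lower e(2) assms(2) by (intro mult_left_mono) auto
  moreover have "(q - p) * (m / 2) = 4 * \<eta>" by (simp add: \<eta>_def)
  ultimately show False using \<open>\<eta> > 0\<close> by linarith
qed

section \<open>From slopes to derivatives\<close>

lemma has_derivative_if_slopes_converge:
  fixes g :: "real \<Rightarrow> real"
  assumes "\<And>e. e > 0 \<Longrightarrow> \<exists>d>0. \<forall>u v. u < v \<longrightarrow> x \<in> {u..v} \<longrightarrow> v - u < d \<longrightarrow>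
     \<bar>(g v - g u) - L * (v - u)\<bar> < e * (v - u)"
  shows "(g has_real_derivative L) (at x)"
  unfolding has_field_derivative_iff
proof (rule LIM_I)
  fix e :: real assume "e > 0"
  then obtain d where d: "d > 0"
    "\<And>u v. \<lbrakk>u < v; x \<in> {u..v}; v - u < d\<rbrakk> \<Longrightarrow> \<bar>(g v - g u) - L * (v - u)\<bar> < e * (v - u)"
    using assms[of e] by metis
  have "norm ((g y - g x) / (y - x) - L) < e" if y: "y \<noteq> x" "norm (y - x) < d" for y
  proof -
    have *: "(g y - g x) / (y - x) - L = ((g y - g x) - L * (y - x)) / (y - x)"
      using y(1) by (simp add: field_simps)
    have "\<bar>(g y - g x) - L * (y - x)\<bar> < e * \<bar>y - x\<bar>"
    proof (cases "x < y")
      case True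
      then show ?thesis using d(2)[of x y] y by simp
    next
      case False
      then have "\<bar>(g x - g y) - L * (x - y)\<bar> < e * (x - y)" using d(2)[of y x] y by simp
      moreover have "(g x - g y) - L * (x - y) = - ((g y - g x) - L * (y - x))"
        by (simp add: algebra_simps)
      ultimately show ?thesis using False by (simp only: abs_minus_cancel) simp
    qed
    then show ?thesis unfolding * using y(1) by (simp add: field_simps)
  qed
  then show "\<exists>d>0. \<forall>y. y \<noteq> x \<and> norm (y - x) < d \<longrightarrow> norm ((g y - g x) / (y - x) - L) < e"
    using d(1) by blast
qed

text \<open>The derivative is \<open>Inf Q\<close>, the upper derivate. Members of \<open>Q\<close>
  just above it bound all short slopes from above. A rational \<open>q\<close> just below it is
  steep, so by \<open>agree\<close> any smaller rational \<open>p\<close> bounds all short slopes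
  from below. Rationals suffice by density, which keeps the exceptional set a countable
  union.\<close>

lemma differentiable_if_slopes_agree:
  assumes up: "\<not> steep g M x" and lo: "\<not> steep (\<lambda>x. - g x) M' x"
    and agree: "\<And>p q. \<lbrakk>p \<in> \<rat>; q \<in> \<rat>; p < q; steep g q x\<rbrakk> \<Longrightarrow> \<not> steep (\<lambda>x. - g x) (- p) x"
  shows "\<exists>L. (g has_real_derivative L) (at x)"
proof -
  define Q where "Q = {q. \<not> steep g q x}"
  have "M \<in> Q" using up by (simp add: Q_def)
  obtain d0 where d0: "d0 > 0" "\<And>u v. \<lbrakk>u < v; x \<in> {u..v}; v - u < d0\<rbrakk> \<Longrightarrow> - g v - - g u < M' * (v - u)"
    using not_steepE[OF lo] by metis
  \<comment> \<open>By \<open>lo\<close>, all sufficiently short intervals at \<open>x\<close> have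
    slope above \<open>- M'\<close>, so any of them is a witness. As a result \<open>Q\<close> is
    bounded below and \<open>Inf Q\<close> is meaningful.\<close>
  have "steep g (- M') x"
    unfolding steep_def
  proof (intro allI impI)
    fix d :: real assume "d > 0"
    define t where "t = min d d0 / 2"
    have "t > 0" "t < d" "t < d0" using \<open>d > 0\<close> d0(1) by (auto simp: t_def)
    then have "- M' * t \<le> g (x + t) - g x" using d0(2)[of x "x + t"] by simp
    then show "\<exists>p. fst p < snd p \<and> x \<in> {fst p..snd p} \<and> incr (\<lambda>x. x) p < d \<and>
      - M' * incr (\<lambda>x. x) p \<le> incr g p"
      using \<open>t > 0\<close> \<open>t < d\<close> by (intro exI[of _ "(x, x + t)"]) (simp add: incr_def)
  qed
  then have "- M' \<le> q" if "q \<in> Q" for q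
    using that steep_antimono[of g "- M'" x q] by (force simp: Q_def)
  then have bdd: "bdd_below Q" by (rule bdd_belowI)
  have "(g has_real_derivative Inf Q) (at x)"
  proof (rule has_derivative_if_slopes_converge)
    fix e :: real assume "e > 0"
    obtain r where r: "r \<in> Q" "r < Inf Q + e"
      using cInf_lessD[of Q "Inf Q + e"] \<open>M \<in> Q\<close> \<open>e > 0\<close> by auto
    obtain d1 where d1: "d1 > 0" "\<And>u v. \<lbrakk>u < v; x \<in> {u..v}; v - u < d1\<rbrakk> \<Longrightarrow> g v - g u < r * (v - u)"
      using not_steepE[of g r x] r(1) unfolding Q_def by blast
    obtain q where q: "q \<in> \<rat>" "Inf Q - e < q" "q < Inf Q"
      using Rats_dense_in_real[of "Inf Q - e" "Inf Q"] \<open>e > 0\<close> by auto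
    obtain p where p: "p \<in> \<rat>" "Inf Q - e < p" "p < q"
      using Rats_dense_in_real[OF q(2)] by blast
    have "steep g q x" using q(3) cInf_lower[OF _ bdd, of q] by (force simp: Q_def)
    then have "\<not> steep (\<lambda>x. - g x) (- p) x" using agree p q by blast
    then obtain d2 where d2: "d2 > 0"
      "\<And>u v. \<lbrakk>u < v; x \<in> {u..v}; v - u < d2\<rbrakk> \<Longrightarrow> - g v - - g u < - p * (v - u)"
      using not_steepE by blast
    have "\<bar>(g v - g u) - Inf Q * (v - u)\<bar> < e * (v - u)"
      if uv: "u < v" "x \<in> {u..v}" "v - u < min d1 d2" for u v
    proof -
      have "g v - g u < r * (v - u)" "p * (v - u) < g v - g u"
        using d1(2)[of u v] d2(2)[of u v] uv by auto
      moreover have "r * (v - u) \<le> (Inf Q + e) * (v - u)" "(Inf Q - e) * (v - u) \<le> p * (v - u)"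
        using r p uv by (auto intro!: mult_right_mono)
      ultimately show ?thesis by (simp add: abs_less_iff algebra_simps)
    qed
    then show "\<exists>d>0. \<forall>u v. u < v \<longrightarrow> x \<in> {u..v} \<longrightarrow> v - u < d \<longrightarrow>
      \<bar>(g v - g u) - Inf Q * (v - u)\<bar> < e * (v - u)"
      using d1(1) d2(1) by (intro exI[of _ "min d1 d2"]) auto
  qed
  then show ?thesis by blast
qed

theorem abs_cont_on_differentiable_AE:
  assumes "abs_cont_on a b g"
  obtains N where "negligible N"
    "\<And>x. x \<in> {a<..<b} - N \<Longrightarrow> \<exists>L. (g has_real_derivative L) (at x)"
proof -
  let ?E = "\<lambda>r. {x\<in>{a<..<b}. steep g (snd r) x \<and> steep (\<lambda>x. - g x) (- fst r) x}"
  let ?P = "{r \<in> \<rat> \<times> \<rat>. fst r < snd r}"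
  define N where "N = \<Union>(?E ` ?P) \<union> {x\<in>{a<..<b}. \<forall>M. steep g M x} \<union>
    {x\<in>{a<..<b}. \<forall>M. steep (\<lambda>x. - g x) M x}"
  have "countable ?P"
    by (rule countable_subset[of _ "\<rat> \<times> \<rat>"]) (auto intro: countable_rat)
  then have "negligible (\<Union>(?E ` ?P))"
    using negligible_distinct_slopes[OF assms] by (intro negligible_countable_Union) auto
  then have "negligible N"
    unfolding N_def using negligible_infinite_slope[OF assms]
      negligible_infinite_slope[OF abs_cont_on_uminus[OF assms]] by auto
  moreover have "\<exists>L. (g has_real_derivative L) (at x)" if x: "x \<in> {a<..<b} - N" for x
  proof -
    obtain M where "\<not> steep g M x" using x by (auto simp: N_def)
    moreover obtain M' where "\<not> steep (\<lambda>x. - g x) M' x" using x by (auto simp: N_def)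
    ultimately show ?thesis
      by (rule differentiable_if_slopes_agree) (use x in \<open>auto simp: N_def\<close>)
  qed
  ultimately show thesis by (rule that)
qed

section \<open>The fundamental theorem of calculus\<close>

text \<open>The straddle lemma: split the increment at \<open>x\<close> and add the two one-sided
  errors. Closeness is phrased by a ball containing the whole interval because that is what fineness
  of a gauge supplies.\<close>

lemma real_derivative_straddle:
  assumes "(g has_real_derivative D) (at x within A)" "c > 0"
  shows "\<exists>d>0. \<forall>u\<in>A. \<forall>v\<in>A. u \<le> x \<longrightarrow> x \<le> v \<longrightarrow> {u..v} \<subseteq> ball x d \<longrightarrow>
    \<bar>(g v - g u) - (v - u) * D\<bar> \<le> c * (v - u)"
proof -
  have "(g has_derivative (\<lambda>h. h * D)) (at x within A)"
    using assms(1) by (simp add: has_field_derivative_def mult_commute_abs)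
  then obtain d where "d > 0"
    "\<forall>y\<in>A. norm (y - x) < d \<longrightarrow> norm (g y - g x - (y - x) * D) \<le> c * norm (y - x)"
    using assms(2) unfolding has_derivative_within_alt by blast
  then have d: "d > 0" "\<And>y. y \<in> A \<Longrightarrow> \<bar>y - x\<bar> < d \<Longrightarrow> \<bar>g y - g x - (y - x) * D\<bar> \<le> c * \<bar>y - x\<bar>"
    by auto
  have "\<bar>(g v - g u) - (v - u) * D\<bar> \<le> c * (v - u)"
    if uv: "u \<in> A" "v \<in> A" "u \<le> x" "x \<le> v" "{u..v} \<subseteq> ball x d" for u v
  proof -
    have "u \<in> {u..v}" "v \<in> {u..v}" using uv(3,4) by auto
    then have "u \<in> ball x d" "v \<in> ball x d" using uv(5) by blast+
    then have "\<bar>g u - g x - (u - x) * D\<bar> \<le> c * (x - u)" "\<bar>g v - g x - (v - x) * D\<bar> \<le> c * (v - x)"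
      using d(2)[of u] d(2)[of v] uv by (auto simp: dist_real_def)
    moreover have "(g v - g u) - (v - u) * D = (g v - g x - (v - x) * D) - (g u - g x - (u - x) * D)"
      by (simp add: algebra_simps)
    moreover have "c * (v - u) = c * (v - x) + c * (x - u)" by (simp add: algebra_simps)
    ultimately show ?thesis by linarith
  qed
  then show ?thesis using d(1) by blast
qed

text \<open>The tags outside the exceptional set are controlled by the derivative, the others by absolute
  continuity, their intervals being confined to an open set of small measure.\<close>

lemma abs_cont_on_has_integral_0:
  assumes ac: "abs_cont_on a b g" and "a \<le> b" and N: "negligible N"
    and deriv: "\<And>x. x \<in> {a..b} - N \<Longrightarrow> (g has_real_derivative h x) (at x within {a..b})"
    and h0: "\<And>x. x \<in> N \<Longrightarrow> h x = 0"
  shows "(h has_integral (g b - g a)) {a..b}"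
  unfolding has_integral_real
proof (intro allI impI)
  fix e :: real assume "e > 0"
  \<comment> \<open>Errors at good tags add up to at most \<open>c * (b - a)\<close>, half of the
    tolerance; the added 1 covers \<open>a = b\<close>.\<close>
  define c where "c = e / (2 * (b - a + 1))"
  have c: "c > 0" "c * (b - a) \<le> e / 2"
    using \<open>e > 0\<close> \<open>a \<le> b\<close> by (auto simp: c_def field_simps)
  show "\<exists>\<gamma>. gauge \<gamma> \<and> (\<forall>\<D>. \<D> tagged_division_of {a..b} \<and> \<gamma> fine \<D> \<longrightarrow>
     norm ((\<Sum>(x, k)\<in>\<D>. measure lborel k *\<^sub>R h x) - (g b - g a)) < e)"
  proof (rule abs_cont_onE[OF ac, where 'i="real \<times> real set" and \<epsilon>="e / 2"])
    fix \<delta> :: real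
    assume "\<delta> > 0" and AC: "\<And>(J::(real \<times> real set) set) u v. \<lbrakk>finite J; \<And>i. i \<in> J \<Longrightarrow> a \<le> u i \<and> u i \<le> v i \<and> v i \<le> b;
       pairwise (\<lambda>i j. v i \<le> u j \<or> v j \<le> u i) J; (\<Sum>i\<in>J. v i - u i) < \<delta>\<rbrakk>
       \<Longrightarrow> (\<Sum>i\<in>J. \<bar>g (v i) - g (u i)\<bar>) < e / 2"
    obtain U where U: "open U" "N \<subseteq> U" "U \<in> lmeasurable" "measure lebesgue U < \<delta>"
      using lmeasurable_outer_open[of N \<delta>] N \<open>\<delta> > 0\<close> by (auto simp: negligible_iff_measure)
    have "\<exists>d>0. (x \<in> N \<longrightarrow> ball x d \<subseteq> U) \<and> (x \<in> {a..b} - N \<longrightarrow>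
        (\<forall>u\<in>{a..b}. \<forall>v\<in>{a..b}. u \<le> x \<longrightarrow> x \<le> v \<longrightarrow> {u..v} \<subseteq> ball x d \<longrightarrow>
          \<bar>(g v - g u) - (v - u) * h x\<bar> \<le> c * (v - u)))" for x
    proof (cases "x \<in> N")
      case True
      then obtain d where "d > 0" "ball x d \<subseteq> U" using U openE by blast
      then show ?thesis using True by blast
    next
      case False
      then show ?thesis
        using real_derivative_straddle[OF deriv c(1), of x]
        by (cases "x \<in> {a..b}") (auto intro: exI[of _ 1])
    qed
    then obtain d where d: "\<And>x. d x > 0" "\<And>x. x \<in> N \<Longrightarrow> ball x (d x) \<subseteq> U"
      "\<And>x u v. \<lbrakk>x \<in> {a..b} - N; u \<in> {a..b}; v \<in> {a..b}; u \<le> x; x \<le> v; {u..v} \<subseteq> ball x (d x)\<rbrakk> \<Longrightarrow>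
          \<bar>(g v - g u) - (v - u) * h x\<bar> \<le> c * (v - u)"
      by metis
    define \<gamma> where "\<gamma> x = ball x (d x)" for x
    have gauge: "gauge \<gamma>" using d(1) by (auto simp: gauge_def \<gamma>_def)
    have est: "norm ((\<Sum>(x, k)\<in>\<D>. measure lborel k *\<^sub>R h x) - (g b - g a)) < e"
      if \<D>: "\<D> tagged_division_of {a..b}" "\<gamma> fine \<D>" for \<D>
    proof -
      \<comment> \<open>The second component of a tagged interval is a set; \<open>Inf\<close> and
        \<open>Sup\<close> recover its endpoints.\<close>
      let ?l = "\<lambda>i::real \<times> real set. Inf (snd i)" and ?r = "\<lambda>i::real \<times> real set. Sup (snd i)"
      have fin: "finite \<D>" using \<D>(1) by blast
      have tag: "snd i = {?l i..?r i}" "fst i \<in> {?l i..?r i}" "{?l i..?r i} \<subseteq> ball (fst i) (d (fst i))"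
        "a \<le> ?l i" "?r i \<le> b"
        if i: "i \<in> \<D>" for i
      proof -
        obtain x k where xk: "i = (x, k)" by (cases i)
        obtain u v where k: "k = {u..v}"
          using tagged_division_ofD(4)[OF \<D>(1)] i xk by (metis box_real(2))
        have x: "x \<in> k" "k \<subseteq> {a..b}"
          using tagged_division_ofD(2,3)[OF \<D>(1)] i xk by auto
        have "k \<subseteq> \<gamma> x" using \<D>(2) i xk by (auto simp: fine_def)
        then show "snd i = {?l i..?r i}" "fst i \<in> {?l i..?r i}" "{?l i..?r i} \<subseteq> ball (fst i) (d (fst i))"
          "a \<le> ?l i" "?r i \<le> b"
          using x k xk by (auto simp: \<gamma>_def)
      qed
      have le: "?l i \<le> ?r i" if "i \<in> \<D>" for i using tag(2)[OF that] by simp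
      have cont: "measure lborel (snd i) = ?r i - ?l i" if "i \<in> \<D>" for i
        using tag(1)[OF that] le[OF that] by (metis measure_lborel_Icc)
      \<comment> \<open>Degenerate intervals are excluded: a tagged division only has disjoint
        interiors, so a single point may sit inside another interval and violate the ordering of
        endpoints. It contributes nothing to either sum.\<close>
      define J where "J = {i \<in> \<D>. fst i \<in> N \<and> ?l i < ?r i}"
      have JD: "J \<subseteq> \<D>" "finite J" using fin by (auto simp: J_def)
      have disj: "{?l i<..<?r i} \<inter> {?l j<..<?r j} = {}" if "i \<in> \<D>" "j \<in> \<D>" "i \<noteq> j" for i j
      proof -
        have "interior (snd i) \<inter> interior (snd j) = {}"
          using tagged_division_ofD(5)[OF \<D>(1), of "fst i" "snd i" "fst j" "snd j"] that
          by (simp add: prod_eq_iff)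
        moreover have "interior (snd i) = {?l i<..<?r i}" if "i \<in> \<D>" for i
          by (subst tag(1)[OF that]) (rule interior_atLeastAtMost_real)
        ultimately show ?thesis using that by simp
      qed
      have "(\<Sum>i\<in>J. \<bar>g (?r i) - g (?l i)\<bar>) < e / 2"
      proof (rule AC[OF JD(2)])
        show "a \<le> ?l i \<and> ?l i \<le> ?r i \<and> ?r i \<le> b" if "i \<in> J" for i
          using tag[of i] le[of i] that JD by auto
        show "pairwise (\<lambda>i j. ?r i \<le> ?l j \<or> ?r j \<le> ?l i) J"
          unfolding pairwise_def
        proof (intro ballI impI)
          fix i j assume ij: "i \<in> J" "j \<in> J" "i \<noteq> j"
          show "?r i \<le> ?l j \<or> ?r j \<le> ?l i"
          proof (rule ccontr)
            assume *: "\<not> ?thesis"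
            have "?l i < ?r i" "?l j < ?r j" using ij by (auto simp: J_def)
            with * have "max (?l i) (?l j) < min (?r i) (?r j)" by auto
            then obtain z where "max (?l i) (?l j) < z" "z < min (?r i) (?r j)" using dense by blast
            then have "z \<in> {?l i<..<?r i} \<inter> {?l j<..<?r j}" by auto
            then show False using disj[of i j] ij JD(1) by blast
          qed
        qed
        have disjJ: "disjnt {?l i<..<?r i} {?l j<..<?r j}" if "i \<in> J" "j \<in> J" "i \<noteq> j" for i j
          using disj that JD(1) unfolding disjnt_def by blast
        have "(\<Sum>i\<in>J. ?r i - ?l i) = (\<Sum>i\<in>J. measure lebesgue {?l i<..<?r i})"
          using le JD(1) by (intro sum.cong) auto
        also have "\<dots> = measure lebesgue (\<Union>i\<in>J. {?l i<..<?r i})"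
          by (intro measure_UNION'[symmetric] JD(2) pairwiseI disjJ) auto
        also have "\<dots> \<le> measure lebesgue U"
        proof (rule measure_mono_fmeasurable[OF _ _ U(3)])
          show "(\<Union>i\<in>J. {?l i<..<?r i}) \<subseteq> U"
          proof (rule UN_least)
            fix i assume "i \<in> J"
            then have "i \<in> \<D>" "fst i \<in> N" by (auto simp: J_def)
            then show "{?l i<..<?r i} \<subseteq> U"
              using tag(3)[of i] d(2)[of "fst i"] by force
          qed
        qed (use JD(2) in \<open>auto intro!: sets.finite_UN\<close>)
        also have "\<dots> < \<delta>" by (rule U(4))
        finally show "(\<Sum>i\<in>J. ?r i - ?l i) < \<delta>" .
      qed
      moreover have "(\<Sum>i\<in>J. \<bar>g (?r i) - g (?l i)\<bar>) = (\<Sum>i\<in>\<D>. if i \<in> J then \<bar>g (?r i) - g (?l i)\<bar> else 0)"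
        using JD fin by (simp add: sum.If_cases Int_absorb1)
      moreover have "(\<Sum>i\<in>\<D>. c * (?r i - ?l i)) \<le> e / 2"
      proof -
        have "(\<Sum>i\<in>\<D>. ?r i - ?l i) = b - a"
          using additive_tagged_division_1[OF \<open>a \<le> b\<close> \<D>(1), of "\<lambda>x. x"]
          by (simp add: case_prod_unfold)
        then show ?thesis using c(2) by (simp add: sum_distrib_left[symmetric])
      qed
      moreover have "(\<Sum>i\<in>\<D>. \<bar>measure lborel (snd i) * h (fst i) - (g (?r i) - g (?l i))\<bar>) \<le>
        (\<Sum>i\<in>\<D>. c * (?r i - ?l i)) + (\<Sum>i\<in>\<D>. if i \<in> J then \<bar>g (?r i) - g (?l i)\<bar> else 0)"
        unfolding sum.distrib[symmetric]
      proof (rule sum_mono)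
        fix i assume i: "i \<in> \<D>"
        show "\<bar>measure lborel (snd i) * h (fst i) - (g (?r i) - g (?l i))\<bar> \<le>
          c * (?r i - ?l i) + (if i \<in> J then \<bar>g (?r i) - g (?l i)\<bar> else 0)"
        proof (cases "fst i \<in> N")
          case True
          then show ?thesis
            using h0[OF True] i le[OF i] c(1) by (cases "?l i < ?r i") (auto simp: J_def abs_minus_commute)
        next
          case False
          have "\<bar>(g (?r i) - g (?l i)) - (?r i - ?l i) * h (fst i)\<bar> \<le> c * (?r i - ?l i)"
            using tag(2-5)[OF i] False by (intro d(3)) auto
          then show ?thesis using False i by (auto simp: J_def cont abs_minus_commute)
        qed
      qed
      ultimately have *: "(\<Sum>i\<in>\<D>. \<bar>measure lborel (snd i) * h (fst i) - (g (?r i) - g (?l i))\<bar>) < e"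
        by linarith
      have "(\<Sum>i\<in>\<D>. g (?r i) - g (?l i)) = g b - g a"
        using additive_tagged_division_1[OF \<open>a \<le> b\<close> \<D>(1), of g] by (simp add: case_prod_unfold)
      then have "norm ((\<Sum>(x, k)\<in>\<D>. measure lborel k *\<^sub>R h x) - (g b - g a)) =
        \<bar>\<Sum>i\<in>\<D>. measure lborel (snd i) * h (fst i) - (g (?r i) - g (?l i))\<bar>"
        by (simp add: case_prod_unfold sum_subtractf)
      also have "\<dots> < e" by (rule le_less_trans[OF sum_abs *])
      finally show ?thesis .
    qed
    show ?thesis
    proof (intro exI conjI allI impI)
      show "gauge \<gamma>" by (rule gauge)
      fix \<D> assume "\<D> tagged_division_of {a..b} \<and> \<gamma> fine \<D>"
      then show "norm ((\<Sum>(x, k)\<in>\<D>. measure lborel k *\<^sub>R h x) - (g b - g a)) < e"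
        by (elim conjE) (rule est)
    qed
  qed (use \<open>e > 0\<close> in simp)
qed

text \<open>Resetting \<open>h\<close> to zero on a null set does not affect the integral. This is
  what makes the values of \<open>deriv\<close> at points of nondifferentiability harmless.\<close>

theorem abs_cont_on_has_integral:
  assumes ac: "abs_cont_on a b g" and "a \<le> b" and N: "negligible N"
    and deriv: "\<And>x. x \<in> {a..b} - N \<Longrightarrow> (g has_real_derivative h x) (at x within {a..b})"
  shows "(h has_integral (g b - g a)) {a..b}"
proof (rule has_integral_spike[OF N])
  show "((\<lambda>x. if x \<in> N then 0 else h x) has_integral (g b - g a)) {a..b}"
    using deriv by (intro abs_cont_on_has_integral_0[OF ac \<open>a \<le> b\<close> N]) auto
qed simp

section \<open>Improper integrals and the functions f1*, f2*\<close>

lemma to_x0_neq_bot: "to_x0 x0 \<noteq> bot"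
  by (simp add: to_x0_def trivial_limit_at_left_real)

lemma Icc_subset_Ival:
  assumes "a \<in> Ival T x0" "b \<in> Ival T x0"
  shows "{a..b} \<subseteq> Ival T x0"
proof
  fix t assume t: "t \<in> {a..b}"
  then have "ereal t \<le> ereal b" by simp
  also have "\<dots> < x0" using assms(2) by (simp add: Ival_def)
  finally show "t \<in> Ival T x0" using assms(1) t by (simp add: Ival_def)
qed

lemma eventually_to_x0:
  assumes "x \<in> Ival T x0"
  shows "eventually (\<lambda>y. x \<le> y \<and> y \<in> Ival T x0) (to_x0 x0)"
proof (cases x0)
  case (real r)
  then have "x < r" using assms by (simp add: Ival_def)
  then have "eventually (\<lambda>y. y \<in> {x<..<r}) (at_left r)" by (rule eventually_at_left_real)
  then show ?thesis
    using assms real by (auto simp: to_x0_def Ival_def elim!: eventually_mono)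
next
  case PInf
  have "eventually (\<lambda>y. x \<le> y \<and> y \<in> Ival T x0) at_top"
    using eventually_ge_at_top[of x] by (rule eventually_mono) (use assms PInf in \<open>auto simp: Ival_def\<close>)
  then show ?thesis using PInf by (simp add: to_x0_def)
next
  case MInf
  then show ?thesis using assms by (simp add: Ival_def)
qed

text \<open>Near \<open>x0\<close> the integral is \<open>H y - H x\<close>, so the two limits
  differ by a constant. In particular, convergence does not depend on the starting point.\<close>

lemma tendsto_integral_iff:
  assumes prim: "\<forall>x\<in>Ival T x0. \<forall>y\<in>Ival T x0. x \<le> y \<longrightarrow> (g has_integral (H y - H x)) {x..y}"
    and x: "x \<in> Ival T x0"
  shows "((\<lambda>y. integral {x..y} g) \<longlongrightarrow> l) (to_x0 x0) \<longleftrightarrow> (H \<longlongrightarrow> l + H x) (to_x0 x0)"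
proof -
  have "eventually (\<lambda>y. integral {x..y} g = H y - H x) (to_x0 x0)"
    using eventually_to_x0[OF x] by (rule eventually_mono) (use prim x in \<open>auto intro: integral_unique\<close>)
  then have "((\<lambda>y. integral {x..y} g) \<longlongrightarrow> l) (to_x0 x0) \<longleftrightarrow> ((\<lambda>y. H y - H x) \<longlongrightarrow> l) (to_x0 x0)"
    by (rule tendsto_cong)
  also have "\<dots> \<longleftrightarrow> (H \<longlongrightarrow> l + H x) (to_x0 x0)"
    using tendsto_add_const_iff[of "- H x" H "l + H x" "to_x0 x0"] by simp
  finally show ?thesis .
qed

lemma imp_conv_primitive_iff:
  assumes prim: "\<forall>x\<in>Ival T x0. \<forall>y\<in>Ival T x0. x \<le> y \<longrightarrow> (g has_integral (H y - H x)) {x..y}"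
    and x: "x \<in> Ival T x0"
  shows "imp_conv x x0 g \<longleftrightarrow> (\<exists>l. (H \<longlongrightarrow> l) (to_x0 x0))"
proof -
  have "g integrable_on {x..y}" if "x \<le> y" "ereal y < x0" for y
  proof -
    have "y \<in> Ival T x0" using x that by (simp add: Ival_def)
    then show ?thesis using prim x that(1) by (blast intro: has_integral_integrable)
  qed
  then have "imp_conv x x0 g \<longleftrightarrow> (\<exists>l. (H \<longlongrightarrow> l + H x) (to_x0 x0))"
    unfolding imp_conv_def tendsto_integral_iff[OF prim x] by blast
  also have "\<dots> \<longleftrightarrow> (\<exists>l. (H \<longlongrightarrow> l) (to_x0 x0))"
    by (metis diff_add_cancel)
  finally show ?thesis .
qed

lemma tail_int_primitive:
  assumes prim: "\<forall>x\<in>Ival T x0. \<forall>y\<in>Ival T x0. x \<le> y \<longrightarrow> (g has_integral (H y - H x)) {x..y}"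
    and x: "x \<in> Ival T x0" and lim: "(H \<longlongrightarrow> l) (to_x0 x0)"
  shows "tail_int x0 g x = l - H x"
  unfolding tail_int_def
proof (rule tendsto_Lim[OF to_x0_neq_bot])
  show "((\<lambda>y. integral {x..y} g) \<longlongrightarrow> l - H x) (to_x0 x0)"
    using tendsto_integral_iff[OF prim x, of "l - H x"] lim by simp
qed

text \<open>Meant for replacing a tail integral by \<open>f1s t - a1\<close>, an equality available
  only for \<open>t\<close> in the interval.\<close>

lemma imp_conv_cong:
  assumes T: "ereal T < x0" and eq: "\<And>t. t \<in> Ival T x0 \<Longrightarrow> g t = h t"
  shows "imp_conv T x0 g \<longleftrightarrow> imp_conv T x0 h"
proof -
  have eqy: "g t = h t" if "t \<in> {T..y}" "ereal y < x0" for t y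
    using Icc_subset_Ival[of T T x0 y] that T by (intro eq) (auto simp: Ival_def)
  have "g integrable_on {T..y} \<longleftrightarrow> h integrable_on {T..y}" if "ereal y < x0" for y
    using eqy that by (intro integrable_cong) auto
  moreover have "((\<lambda>y. integral {T..y} g) \<longlongrightarrow> l) (to_x0 x0) \<longleftrightarrow> ((\<lambda>y. integral {T..y} h) \<longlongrightarrow> l) (to_x0 x0)" for l
  proof (rule tendsto_cong)
    have "T \<in> Ival T x0" using T by (simp add: Ival_def)
    from eventually_to_x0[OF this]
    show "eventually (\<lambda>y. integral {T..y} g = integral {T..y} h) (to_x0 x0)"
      by (rule eventually_mono) (auto intro!: integral_cong eqy simp: Ival_def)
  qed
  ultimately show ?thesis by (auto simp: imp_conv_def)
qed

section \<open>Primitives of the integrands\<close>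

lemma f_star_primitives:
  fixes x0 :: ereal and T :: real
    and \<phi>1 \<phi>1' \<phi>2 \<phi>2' f f' :: "real \<Rightarrow> real"
  defines "I \<equiv> Ival T x0"
    and "W \<equiv> Wr \<phi>1 \<phi>1' \<phi>2 \<phi>2'"
  defines "Lf \<equiv> Lop \<phi>1 \<phi>1' \<phi>2 \<phi>2' f f'"
    and "f1s \<equiv> (\<lambda>t. Wr f f' \<phi>2 \<phi>2' t / W t)"
    and "f2s \<equiv> (\<lambda>t. - Wr f f' \<phi>1 \<phi>1' t / W t)"
  assumes ac: "AC1 T x0 \<phi>1 \<phi>1'" "AC1 T x0 \<phi>2 \<phi>2'" "AC1 T x0 f f'"
    and nz1: "\<forall>x\<in>I. \<phi>1 x \<noteq> 0" and nzW: "\<forall>x\<in>I. W x \<noteq> 0"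
    and a: "a \<in> I" and b: "b \<in> I" and "a \<le> b"
  shows "((\<lambda>t. \<phi>2 t / W t * Lf t) has_integral (f1s a - f1s b)) {a..b}"
    and "((\<lambda>t. \<phi>1 t / W t * Lf t) has_integral (f2s b - f2s a)) {a..b}"
proof -
  have sub: "{a..b} \<subseteq> I"
    using Icc_subset_Ival[of a T x0 b] a b by (simp add: I_def)
  then have subo: "s \<in> I" if "s \<in> {a<..<b}" for s
    using that greaterThanLessThan_subseteq_atLeastAtMost_iff[of a b a b] by auto
  have AC1D: "abs_cont_on a b g" "abs_cont_on a b g'" "continuous_on {a..b} g" "continuous_on {a..b} g'"
    "\<And>x. x \<in> {a<..<b} \<Longrightarrow> (g has_real_derivative g' x) (at x)" if g: "AC1 T x0 g g'" for g g'
  proof -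
    have d: "(g has_real_derivative g' x) (at x within I)" if "x \<in> I" for x
      using g that by (simp add: AC1_def I_def)
    have d': "(g has_real_derivative g' x) (at x within {a..b})" if "x \<in> {a..b}" for x
      using d sub that by (blast intro: DERIV_subset)
    then show "continuous_on {a..b} g" by (rule DERIV_continuous_on)
    show c: "continuous_on {a..b} g'"
      using g sub by (auto simp: AC1_def I_def intro: continuous_on_subset)
    show "abs_cont_on a b g" by (rule abs_cont_on_C1[OF d' c])
    show "abs_cont_on a b g'" using g a b by (simp add: AC1_def I_def Ival_def)
    show "(g has_real_derivative g' x) (at x)" if "x \<in> {a<..<b}" for x
    proof -
      have "(g has_real_derivative g' x) (at x within {a<..<b})"
        by (rule DERIV_subset[OF d'[of x]]) (use that in auto)
      moreover have "at x within {a<..<b} = at x"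
        using that by (intro at_within_open) auto
      ultimately show ?thesis by simp
    qed
  qed
  note \<phi>1 = AC1D[OF ac(1)] and \<phi>2 = AC1D[OF ac(2)] and f = AC1D[OF ac(3)]
  have Wr_ac: "abs_cont_on a b (Wr g g' h h')" "continuous_on {a..b} (Wr g g' h h')"
    if "AC1 T x0 g g'" "AC1 T x0 h h'" for g g' h h'
  proof -
    note g = AC1D(1-4)[OF that(1)] and h = AC1D(1-4)[OF that(2)]
    show "abs_cont_on a b (Wr g g' h h')"
      unfolding Wr_def by (intro abs_cont_on_diff abs_cont_on_mult g h)
    show "continuous_on {a..b} (Wr g g' h h')"
      unfolding Wr_def by (intro continuous_intros g h)
  qed
  have inv: "abs_cont_on a b (\<lambda>t. inverse (W t))" "continuous_on {a..b} (\<lambda>t. inverse (W t))"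
  proof -
    have nz: "\<forall>t\<in>{a..b}. W t \<noteq> 0" using nzW sub by blast
    show "abs_cont_on a b (\<lambda>t. inverse (W t))"
      using nz unfolding W_def by (intro abs_cont_on_inverse Wr_ac ac) blast
    show "continuous_on {a..b} (\<lambda>t. inverse (W t))"
      using nz unfolding W_def by (intro continuous_on_inverse Wr_ac ac)
  qed
  have acs: "abs_cont_on a b f1s"
    unfolding f1s_def divide_inverse using Wr_ac[OF ac(3,2)] inv by (intro abs_cont_on_mult)
  have "abs_cont_on a b (\<lambda>t. Wr \<phi>1 \<phi>1' f f' t * inverse (W t))"
    using Wr_ac[OF ac(1,3)] inv by (intro abs_cont_on_mult)
  moreover have "Wr \<phi>1 \<phi>1' f f' t * inverse (W t) = f2s t" for t
    by (simp add: f2s_def Wr_def divide_inverse algebra_simps)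
  ultimately have acs2: "abs_cont_on a b f2s" by simp
  obtain N where N: "negligible N" "\<And>x. x \<in> {a<..<b} - N \<Longrightarrow> \<exists>L. (f2s has_real_derivative L) (at x)"
    using abs_cont_on_differentiable_AE[OF acs2] by metis
  \<comment> \<open>The endpoints join the null set because two-sided derivatives are available only
    inside the interval.\<close>
  define N' where "N' = insert a (insert b N)"
  have N': "negligible N'" using N(1) by (simp add: N'_def)
  have cramer: "f t = \<phi>1 t * f1s t + \<phi>2 t * f2s t" "f' t = \<phi>1' t * f1s t + \<phi>2' t * f2s t" if "t \<in> I" for t
  proof -
    have "W t \<noteq> 0" using nzW that by blast
    then have "f t * W t = (\<phi>1 t * f1s t + \<phi>2 t * f2s t) * W t"
      "f' t * W t = (\<phi>1' t * f1s t + \<phi>2' t * f2s t) * W t"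
      by (simp_all add: f1s_def f2s_def field_simps) (simp_all add: W_def Wr_def algebra_simps)
    then show "f t = \<phi>1 t * f1s t + \<phi>2 t * f2s t" "f' t = \<phi>1' t * f1s t + \<phi>2' t * f2s t"
      using \<open>W t \<noteq> 0\<close> by simp_all
  qed
  have der: "(f2s has_real_derivative \<phi>1 t / W t * Lf t) (at t)"
    "(f1s has_real_derivative - (\<phi>2 t / W t * Lf t)) (at t)" if t: "t \<in> {a..b} - N'" for t
  proof -
    have tab: "t \<in> {a<..<b}" and tI: "t \<in> I" using t sub by (auto simp: N'_def)
    have nz: "\<phi>1 t \<noteq> 0" "W t \<noteq> 0" using nz1 nzW tI by auto
    obtain L where L: "(f2s has_real_derivative L) (at t)"
      using N(2)[of t] t tab by (auto simp: N'_def)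
    \<comment> \<open>This is the function whose \<open>deriv\<close> occurs in \<open>Lop\<close>.
      On the interval the squares cancel and it equals \<open>f2s\<close>; agreement on an open
      neighbourhood of \<open>t\<close> suffices to transfer the derivative.\<close>
    let ?G = "\<lambda>t. (\<phi>1 t)\<^sup>2 / Wr \<phi>1 \<phi>1' \<phi>2 \<phi>2' t * ((f' t * \<phi>1 t - f t * \<phi>1' t) / (\<phi>1 t)\<^sup>2)"
    have "(?G has_real_derivative L) (at t)"
    proof (rule has_field_derivative_transform_within_open[OF L _ tab])
      fix s assume "s \<in> {a<..<b}"
      then have "\<phi>1 s \<noteq> 0" using nz1 subo by blast
      moreover have "f' s * \<phi>1 s - f s * \<phi>1' s = - Wr f f' \<phi>1 \<phi>1' s" by (simp add: Wr_def)
      ultimately show "f2s s = ?G s" by (simp add: f2s_def W_def)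
    qed simp
    then have "Lf t = W t / \<phi>1 t * L"
      unfolding Lf_def Lop_def W_def by (simp add: DERIV_imp_deriv)
    then have Lf1: "\<phi>1 t / W t * Lf t = L" and Lf2: "\<phi>2 t / W t * Lf t = \<phi>2 t / \<phi>1 t * L"
      using nz by simp_all
    show "(f2s has_real_derivative \<phi>1 t / W t * Lf t) (at t)" using L Lf1 by simp
    \<comment> \<open>By both Cramer identities the numerator becomes \<open>(\<phi>1' t * f1s t - L
      * \<phi>2 t) * \<phi>1 t - \<phi>1 t * f1s t * \<phi>1' t\<close>. The terms with
      \<open>f1s\<close> cancel, leaving only the multiple of \<open>L\<close>.\<close>
    have "((\<lambda>s. (f s - \<phi>2 s * f2s s) / \<phi>1 s) has_real_derivative
      ((f' t - (\<phi>2' t * f2s t + L * \<phi>2 t)) * \<phi>1 t - (f t - \<phi>2 t * f2s t) * \<phi>1' t) / (\<phi>1 t * \<phi>1 t)) (at t)"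
      using \<phi>1(5)[OF tab] \<phi>2(5)[OF tab] f(5)[OF tab] L nz(1)
      by (intro DERIV_divide DERIV_diff DERIV_mult)
    moreover have "((f' t - (\<phi>2' t * f2s t + L * \<phi>2 t)) * \<phi>1 t - (f t - \<phi>2 t * f2s t) * \<phi>1' t) / (\<phi>1 t * \<phi>1 t)
      = - (\<phi>2 t / W t * Lf t)"
      unfolding Lf2 using nz(1) cramer[OF tI] by (simp add: field_simps)
    ultimately have "((\<lambda>s. (f s - \<phi>2 s * f2s s) / \<phi>1 s) has_real_derivative - (\<phi>2 t / W t * Lf t)) (at t)"
      by simp
    then show "(f1s has_real_derivative - (\<phi>2 t / W t * Lf t)) (at t)"
    proof (rule has_field_derivative_transform_within_open[OF _ _ tab])
      fix s assume "s \<in> {a<..<b}"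
      then have "s \<in> I" by (rule subo)
      then show "(f s - \<phi>2 s * f2s s) / \<phi>1 s = f1s s" using nz1 cramer(1)[of s] by simp
    qed simp
  qed
  show "((\<lambda>t. \<phi>1 t / W t * Lf t) has_integral (f2s b - f2s a)) {a..b}"
    using der(1) by (intro abs_cont_on_has_integral[OF acs2 \<open>a \<le> b\<close> N']) (blast intro: has_field_derivative_at_within)
  have "((\<lambda>t. - (\<phi>2 t / W t * Lf t)) has_integral (f1s b - f1s a)) {a..b}"
    using der(2) by (intro abs_cont_on_has_integral[OF acs \<open>a \<le> b\<close> N']) (blast intro: has_field_derivative_at_within)
  from has_integral_neg[OF this] show "((\<lambda>t. \<phi>2 t / W t * Lf t) has_integral (f1s a - f1s b)) {a..b}"
    by simp
qed

theorem theorem5p2: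
  fixes x0 :: ereal and T :: real
    and \<phi>1 \<phi>1' \<phi>2 \<phi>2' f f' :: "real \<Rightarrow> real"
  defines "I \<equiv> Ival T x0"
    and "F \<equiv> to_x0 x0"
    and "W \<equiv> Wr \<phi>1 \<phi>1' \<phi>2 \<phi>2'"
  defines "Lf \<equiv> Lop \<phi>1 \<phi>1' \<phi>2 \<phi>2' f f'"
    and "f1s \<equiv> (\<lambda>t. Wr f f' \<phi>2 \<phi>2' t / W t)"
    and "f2s \<equiv> (\<lambda>t. - Wr f f' \<phi>1 \<phi>1' t / W t)"
    and "\<Phi> \<equiv> (\<lambda>x. \<phi>2 T * \<phi>1 x - \<phi>1 T * \<phi>2 x)"
  defines "Fs \<equiv> (\<lambda>t. \<phi>1 T * f1s t + \<phi>2 T * f2s t)"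
  assumes Tx0: "ereal T < x0"
    and ac1: "AC1 T x0 \<phi>1 \<phi>1'" and ac2: "AC1 T x0 \<phi>2 \<phi>2'"
    and small: "\<phi>2 \<in> o[F](\<phi>1)"
    and nz1: "\<forall>x\<in>I. \<phi>1 x \<noteq> 0" and nz2: "\<forall>x\<in>I. \<phi>2 x \<noteq> 0"
    and nzW: "\<forall>x\<in>I. W x \<noteq> 0"
    and acf: "AC1 T x0 f f'"
  shows
    "((\<exists>a1. (f1s \<longlongrightarrow> a1) F) \<longleftrightarrow> imp_conv T x0 (\<lambda>t. \<phi>2 t / W t * Lf t)) \<and>
     (\<forall>a1. (f1s \<longlongrightarrow> a1) F \<longrightarrow>
        (\<forall>x\<in>I. f1s x = a1 + tail_int x0 (\<lambda>t. \<phi>2 t / W t * Lf t) x)) \<and>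
     ((\<exists>a1. (f1s \<longlongrightarrow> a1) F \<and>
         imp_conv T x0 (\<lambda>t. ((\<phi>1' t * \<phi>2 t - \<phi>1 t * \<phi>2' t) / (\<phi>2 t)\<^sup>2) * (f1s t - a1)))
      \<longleftrightarrow>
      ((\<forall>t\<in>I. imp_conv t x0 (\<lambda>s. \<phi>2 s / W s * Lf s)) \<and>
       imp_conv T x0 (\<lambda>t. ((\<phi>1' t * \<phi>2 t - \<phi>1 t * \<phi>2' t) / (\<phi>2 t)\<^sup>2) *
                          tail_int x0 (\<lambda>s. \<phi>2 s / W s * Lf s) t))) \<and>
     ((\<exists>a2. (f2s \<longlongrightarrow> a2) F) \<longleftrightarrow> imp_conv T x0 (\<lambda>t. \<phi>1 t / W t * Lf t)) \<and>
     (\<forall>a2. (f2s \<longlongrightarrow> a2) F \<longrightarrow>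
        (\<forall>x\<in>I. f2s x = a2 - tail_int x0 (\<lambda>t. \<phi>1 t / W t * Lf t) x)) \<and>
     ((\<exists>\<gamma>. (Fs \<longlongrightarrow> \<gamma>) F) \<longleftrightarrow> imp_conv T x0 (\<lambda>t. \<Phi> t / W t * Lf t)) \<and>
     (\<forall>\<gamma>. (Fs \<longlongrightarrow> \<gamma>) F \<longrightarrow>
        (\<forall>x\<in>I. Fs x = \<gamma> - tail_int x0 (\<lambda>t. \<Phi> t / W t * Lf t) x))"
proof -
  let ?w = "\<lambda>t. (\<phi>1' t * \<phi>2 t - \<phi>1 t * \<phi>2' t) / (\<phi>2 t)\<^sup>2"
  let ?g1 = "\<lambda>t. \<phi>2 t / W t * Lf t" and ?g2 = "\<lambda>t. \<phi>1 t / W t * Lf t"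
    and ?g = "\<lambda>t. \<Phi> t / W t * Lf t"
  have TI: "T \<in> Ival T x0" using Tx0 by (simp add: Ival_def)
  note prim = f_star_primitives[OF ac1 ac2 acf nz1[unfolded I_def] nzW[unfolded I_def W_def],
    folded W_def Lf_def]
  \<comment> \<open>The double minus fits the pattern \<open>H y - H x\<close> with primitive
    \<open>- f1s\<close>; it accounts for the opposite sign of the tail in the formula for
    \<open>f1s\<close>.\<close>
  have p1: "\<forall>x\<in>Ival T x0. \<forall>y\<in>Ival T x0. x \<le> y \<longrightarrow> (?g1 has_integral (- f1s y - - f1s x)) {x..y}"
    using prim(1) by (simp add: f1s_def I_def)
  have p2: "\<forall>x\<in>Ival T x0. \<forall>y\<in>Ival T x0. x \<le> y \<longrightarrow> (?g2 has_integral (f2s y - f2s x)) {x..y}"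
    using prim(2) by (simp add: f2s_def I_def)
  have p: "\<forall>x\<in>Ival T x0. \<forall>y\<in>Ival T x0. x \<le> y \<longrightarrow> (?g has_integral (Fs y - Fs x)) {x..y}"
  proof (intro ballI impI)
    fix x y assume xy: "x \<in> Ival T x0" "y \<in> Ival T x0" "x \<le> y"
    \<comment> \<open>The coefficients are those of \<Phi>, and the minus sign of its second term
      cancels the one in the primitive \<open>- f1s\<close>, which produces
      \<open>Fs\<close>.\<close>
    have "((\<lambda>t. \<phi>2 T * ?g2 t - \<phi>1 T * ?g1 t) has_integral
        (\<phi>2 T * (f2s y - f2s x) - \<phi>1 T * (- f1s y - - f1s x))) {x..y}"
      by (intro has_integral_diff has_integral_mult_right p1[rule_format] p2[rule_format] xy)
    moreover have "(\<lambda>t. \<phi>2 T * ?g2 t - \<phi>1 T * ?g1 t) = ?g"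
      by (simp add: \<Phi>_def fun_eq_iff diff_divide_distrib left_diff_distrib)
    ultimately show "(?g has_integral (Fs y - Fs x)) {x..y}" by (simp add: Fs_def algebra_simps)
  qed
  have lim1: "imp_conv x x0 ?g1 \<longleftrightarrow> (\<exists>a1. (f1s \<longlongrightarrow> a1) F)" if "x \<in> I" for x
  proof -
    have "(\<exists>l. ((\<lambda>t. - f1s t) \<longlongrightarrow> l) F) \<longleftrightarrow> (\<exists>a1. (f1s \<longlongrightarrow> a1) F)"
      by (metis minus_minus tendsto_minus_cancel_left)
    then show ?thesis
      using imp_conv_primitive_iff[OF p1, of x] that by (simp add: I_def F_def)
  qed
  have tail1: "tail_int x0 ?g1 x = f1s x - a1" if "(f1s \<longlongrightarrow> a1) F" "x \<in> I" for x a1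
    using tail_int_primitive[OF p1, of x "- a1"] tendsto_minus[OF that(1)] that(2) by (simp add: I_def F_def)
  have lim2: "imp_conv T x0 ?g2 \<longleftrightarrow> (\<exists>a2. (f2s \<longlongrightarrow> a2) F)"
    using imp_conv_primitive_iff[OF p2 TI] by (simp add: F_def)
  have tail2: "tail_int x0 ?g2 x = a2 - f2s x" if "(f2s \<longlongrightarrow> a2) F" "x \<in> I" for x a2
    using tail_int_primitive[OF p2] that by (simp add: I_def F_def)
  have lim: "imp_conv T x0 ?g \<longleftrightarrow> (\<exists>\<gamma>. (Fs \<longlongrightarrow> \<gamma>) F)"
    using imp_conv_primitive_iff[OF p TI] by (simp add: F_def)
  have tail: "tail_int x0 ?g x = \<gamma> - Fs x" if "(Fs \<longlongrightarrow> \<gamma>) F" "x \<in> I" for x \<gamma>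
    using tail_int_primitive[OF p] that by (simp add: I_def F_def)
  \<comment> \<open>The factor \<open>?w\<close> is the derivative of
    \<open>\<phi>1 / \<phi>2\<close> by the quotient rule. The two outer integrands agree pointwise
    on the interval, since the inner tail equals \<open>f1s t - a1\<close> there.\<close>
  have iter: "imp_conv T x0 (\<lambda>t. ?w t * (f1s t - a1)) \<longleftrightarrow> imp_conv T x0 (\<lambda>t. ?w t * tail_int x0 ?g1 t)"
    if "(f1s \<longlongrightarrow> a1) F" for a1
    using tail1[OF that] by (intro imp_conv_cong[OF Tx0]) (simp add: I_def)
  \<comment> \<open>The condition for one starting point already gives it for all of them, and
    \<open>T\<close> itself is such a point.\<close>
  have all1: "(\<forall>t\<in>I. imp_conv t x0 ?g1) \<longleftrightarrow> (\<exists>a1. (f1s \<longlongrightarrow> a1) F)"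
    using lim1 TI by (auto simp: I_def)
  show ?thesis
  proof (intro conjI)
    show "(\<exists>a1. (f1s \<longlongrightarrow> a1) F) \<longleftrightarrow> imp_conv T x0 ?g1"
      using lim1[of T] TI by (simp add: I_def)
    show "(\<exists>a1. (f1s \<longlongrightarrow> a1) F \<and> imp_conv T x0 (\<lambda>t. ?w t * (f1s t - a1))) \<longleftrightarrow>
      (\<forall>t\<in>I. imp_conv t x0 ?g1) \<and> imp_conv T x0 (\<lambda>t. ?w t * tail_int x0 ?g1 t)"
      unfolding all1 using iter by blast
  qed (use lim2 lim in \<open>auto simp: tail1 tail2 tail simp del: times_divide_eq_left\<close>)
qed

end
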